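(* Let $T>0$, $p\in[1,\infty)$, $\rho\in(0,1]$, $L,C_0,\kappa\in[1,\infty)$, $m\in[0,\infty)$. Let $f\colon\mathbb R\to\mathbb R$ be Lipschitz continuous with Lipschitz constant $L$ and $|f(0)|\le L$. For every $d\in\mathbb N$ let $g_d\colon\mathbb R^d\to\mathbb R$ be continuous with $$|g_d(x)|\le C_0d^\kappa(1+\|x\|_{\mathbb R^d}^m)\quad\text{for }x\in\mathbb R^d,$$ $$|g_d(x)-g_d(y)|\le C_0d^\kappa R^\kappa\|x-y\|_{\mathbb R^d}^\rho\quad\text{for }R\ge1\text{ and }x,y\in[-R,R]^d.$$ For every $d\in\mathbb N$ let $u_d\colon[0,T]\times\mathbb R^d\to\mathbb R$ be the unique continuous viscosity solution of at most polynomial growth of $$\frac{\partial}{\partial t}u_d(t,x)=\Delta_xu_d(t,x)+f(u_d(t,x)),\quad(t,x)\in(0,T)\times\mathbb R^d,\qquad u_d(0,x)=g_d(x),\ x\in\mathbb R^d.$$ Then there exist constants $C,\alpha\in(0,\infty)$, depending only on $T,p,\rho,L,C_0,\kappa$ and $m$, such that for every $d\in\mathbb N$ and every $\varepsilon\in(0,1]$ there exists a finite expression $\Psi_{d,\varepsilon}\colon\mathbb R^d\to\mathbb R$ over $\mathcal D_0$ satisfying $$\|u_d(T,\cdot)-\Psi_{d,\varepsilon}\|_{L^p([0,1]^d)}\le\varepsilon\quad\text{and}\quad\operatorname{Cost}(\Psi_{d,\varepsilon})\le Cd^\alpha\varepsilon^{-\alpha}.$$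
   Context: Conventions: $\mathbb N=\{1,2,\dots\}$; $r^0=1$ for $r\ge0$. Dictionary: $\mathcal D_0=\{+,-,\times,/,\max\{0,\cdot\},\sin(\cdot),2^{(\cdot)}\}$. A finite expression over $\mathcal D_0$ is a function built from the input coordinates and fixed real constants by finitely many operations from $\mathcal D_0$ (denominators must be nonzero on the domain considered). Each scalar operation has unit cost; reading coordinates and constants has zero cost; computed values may be reused; $\operatorname{Cost}(\Phi)$ is the number of operations in one evaluation of $\Phi$. The solution $u_d$ exists and is unique in the class of continuous functions of at most polynomial growth (growth in $x$, uniformly in $t$), and coincides with the mild solution: for a standard $d$-dimensional Brownian motion $W^d$ and every $(t,x)\in[0,T]\times\mathbb R^d$, $$u_d(t,x)=\mathbb E[g_d(x+\sqrt2W_t^d)]+\int_0^t\mathbb E[f(u_d(s,x+\sqrt2W_{t-s}^d))]\,ds.$$ *)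

theory Defs
  imports "HOL-Analysis.Analysis"
begin

section \<open>Euclidean spaces of variable dimension\<close>

text \<open>
  The constants of the theorem are uniform in the dimension \<open>d\<close>, so \<open>d\<close> cannot be a type. A point
  of the \<open>d\<close>-dimensional Euclidean space is a function on \<open>{..<d}\<close> (undefined elsewhere). This set is the space of
  the product measure \<open>PiM {..<d} (\<lambda>_. lborel)\<close>, and the subspace topology it inherits from the
  product topology on \<open>nat \<Rightarrow> real\<close> is the Euclidean one.
\<close>

definition Rd :: "nat \<Rightarrow> (nat \<Rightarrow> real) set" where
  "Rd d = (\<Pi>\<^sub>E i\<in>{..<d}. UNIV)"

definition norm_Rd :: "nat \<Rightarrow> (nat \<Rightarrow> real) \<Rightarrow> real" where
  "norm_Rd d x = L2_set x {..<d}"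

definition dist_Rd :: "nat \<Rightarrow> (nat \<Rightarrow> real) \<Rightarrow> (nat \<Rightarrow> real) \<Rightarrow> real" where
  "dist_Rd d x y = L2_set (\<lambda>i. x i - y i) {..<d}"

text \<open>
  Real powers with the convention \<open>r\<^sup>0 = 1\<close> for all \<open>r \<ge> 0\<close>; in contrast, \<open>0 powr 0 = 0\<close>.
\<close>

definition rpow :: "real \<Rightarrow> real \<Rightarrow> real" where
  "rpow r a = (if a = 0 then 1 else r powr a)"

section \<open>The norm of \<open>L\<^sup>p\<close>\<close>

definition unit_cube_measure :: "nat \<Rightarrow> (nat \<Rightarrow> real) measure" where
  "unit_cube_measure d =
     restrict_space (PiM {..<d} (\<lambda>_. lborel)) (\<Pi>\<^sub>E i\<in>{..<d}. {0..1})"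

text \<open>
  The Bochner integral of a non-integrable function is \<open>0\<close>, so a bound on \<open>Lp_norm\<close> is meaningful
  only together with \<open>in_Lp\<close>.
\<close>

definition in_Lp :: "'a measure \<Rightarrow> real \<Rightarrow> ('a \<Rightarrow> real) \<Rightarrow> bool" where
  "in_Lp M p h \<longleftrightarrow> h \<in> borel_measurable M \<and> integrable M (\<lambda>x. \<bar>h x\<bar> powr p)"

definition Lp_norm :: "'a measure \<Rightarrow> real \<Rightarrow> ('a \<Rightarrow> real) \<Rightarrow> real" where
  "Lp_norm M p h = (\<integral>x. \<bar>h x\<bar> powr p \<partial>M) powr (1 / p)"

section \<open>Viscosity solutions of the semilinear heat equation\<close>

text \<open>
  \<open>C12 T d \<phi> \<phi>t D1 D2\<close>: \<open>\<phi>\<close> is of class \<open>C\<close> 1 in time and \<open>C\<close> 2 in space on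
  \<open>{0<..<T} \<times> Rd d\<close>, with time derivative \<open>\<phi>t\<close>, spatial gradient \<open>D1\<close> and spatial Hessian \<open>D2\<close>,
  where \<open>D2 i j\<close> is the derivative of \<open>D1 i\<close> in direction \<open>j\<close>.
\<close>

definition C12 ::
  "real \<Rightarrow> nat \<Rightarrow> (real \<Rightarrow> (nat \<Rightarrow> real) \<Rightarrow> real) \<Rightarrow> (real \<Rightarrow> (nat \<Rightarrow> real) \<Rightarrow> real) \<Rightarrow>
   (nat \<Rightarrow> real \<Rightarrow> (nat \<Rightarrow> real) \<Rightarrow> real) \<Rightarrow> (nat \<Rightarrow> nat \<Rightarrow> real \<Rightarrow> (nat \<Rightarrow> real) \<Rightarrow> real) \<Rightarrow> bool" where
  "C12 T d \<phi> \<phi>t D1 D2 \<longleftrightarrow>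
     continuous_on ({0<..<T} \<times> Rd d) (\<lambda>(t, x). \<phi> t x) \<and>
     continuous_on ({0<..<T} \<times> Rd d) (\<lambda>(t, x). \<phi>t t x) \<and>
     (\<forall>i<d. continuous_on ({0<..<T} \<times> Rd d) (\<lambda>(t, x). D1 i t x)) \<and>
     (\<forall>i<d. \<forall>j<d. continuous_on ({0<..<T} \<times> Rd d) (\<lambda>(t, x). D2 i j t x)) \<and>
     (\<forall>t\<in>{0<..<T}. \<forall>x\<in>Rd d.
        ((\<lambda>s. \<phi> s x) has_real_derivative \<phi>t t x) (at t) \<and>
        (\<forall>i<d. ((\<lambda>s. \<phi> t (x(i := s))) has_real_derivative D1 i t x) (at (x i))) \<and>
        (\<forall>i<d. \<forall>j<d. ((\<lambda>s. D1 i t (x(j := s))) has_real_derivative D2 i j t x) (at (x j))))"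

definition viscosity_subsolution ::
  "real \<Rightarrow> nat \<Rightarrow> (real \<Rightarrow> real) \<Rightarrow> (real \<Rightarrow> (nat \<Rightarrow> real) \<Rightarrow> real) \<Rightarrow> bool" where
  "viscosity_subsolution T d f u \<longleftrightarrow>
     (\<forall>\<phi> \<phi>t D1 D2. C12 T d \<phi> \<phi>t D1 D2 \<longrightarrow>
       (\<forall>t\<in>{0<..<T}. \<forall>x\<in>Rd d.
         (\<forall>\<^sub>F (s, y) in at (t, x) within {0<..<T} \<times> Rd d. u s y - \<phi> s y \<le> u t x - \<phi> t x) \<longrightarrow>
         \<phi>t t x \<le> (\<Sum>i<d. D2 i i t x) + f (u t x)))"

definition viscosity_supersolution ::
  "real \<Rightarrow> nat \<Rightarrow> (real \<Rightarrow> real) \<Rightarrow> (real \<Rightarrow> (nat \<Rightarrow> real) \<Rightarrow> real) \<Rightarrow> bool" where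
  "viscosity_supersolution T d f u \<longleftrightarrow>
     (\<forall>\<phi> \<phi>t D1 D2. C12 T d \<phi> \<phi>t D1 D2 \<longrightarrow>
       (\<forall>t\<in>{0<..<T}. \<forall>x\<in>Rd d.
         (\<forall>\<^sub>F (s, y) in at (t, x) within {0<..<T} \<times> Rd d. u s y - \<phi> s y \<ge> u t x - \<phi> t x) \<longrightarrow>
         \<phi>t t x \<ge> (\<Sum>i<d. D2 i i t x) + f (u t x)))"

definition viscosity_solution ::
  "real \<Rightarrow> nat \<Rightarrow> (real \<Rightarrow> real) \<Rightarrow> ((nat \<Rightarrow> real) \<Rightarrow> real) \<Rightarrow>
   (real \<Rightarrow> (nat \<Rightarrow> real) \<Rightarrow> real) \<Rightarrow> bool" where
  "viscosity_solution T d f g u \<longleftrightarrow>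
     continuous_on ({0..T} \<times> Rd d) (\<lambda>(t, x). u t x) \<and>
     viscosity_subsolution T d f u \<and> viscosity_supersolution T d f u \<and>
     (\<forall>x\<in>Rd d. u 0 x = g x)"

definition polynomial_growth ::
  "real \<Rightarrow> nat \<Rightarrow> (real \<Rightarrow> (nat \<Rightarrow> real) \<Rightarrow> real) \<Rightarrow> bool" where
  "polynomial_growth T d u \<longleftrightarrow>
     (\<exists>K. \<exists>n::nat. \<forall>t\<in>{0..T}. \<forall>x\<in>Rd d. \<bar>u t x\<bar> \<le> K * (1 + norm_Rd d x ^ n))"

section \<open>Finite expressions\<close>

text \<open>
  Since computed values may be reused at no cost, an expression is a straight-line program and not
  a term: a list of operations, each acting on input coordinates, real constants and the results
  of earlier operations (\<open>Val k\<close> is the result of operation number \<open>k\<close>, counted from \<open>0\<close>), together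
  with the operand that is returned.
\<close>

datatype operand = Coord nat | Const real | Val nat

datatype operation =
    Add operand operand
  | Sub operand operand
  | Mul operand operand
  | Div operand operand
  | Max0 operand
  | Sin operand
  | Exp2 operand

datatype expression = Expression (operations: "operation list") (result: operand)

fun operand_val :: "(nat \<Rightarrow> real) \<Rightarrow> real list \<Rightarrow> operand \<Rightarrow> real" where
  "operand_val x vs (Coord i) = x i"
| "operand_val x vs (Const c) = c"
| "operand_val x vs (Val k) = vs ! k"

fun operation_val :: "(nat \<Rightarrow> real) \<Rightarrow> real list \<Rightarrow> operation \<Rightarrow> real" where
  "operation_val x vs (Add a b) = operand_val x vs a + operand_val x vs b"
| "operation_val x vs (Sub a b) = operand_val x vs a - operand_val x vs b"
| "operation_val x vs (Mul a b) = operand_val x vs a * operand_val x vs b"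
| "operation_val x vs (Div a b) = operand_val x vs a / operand_val x vs b"
| "operation_val x vs (Max0 a) = max 0 (operand_val x vs a)"
| "operation_val x vs (Sin a) = sin (operand_val x vs a)"
| "operation_val x vs (Exp2 a) = 2 powr operand_val x vs a"

definition run :: "(nat \<Rightarrow> real) \<Rightarrow> operation list \<Rightarrow> real list" where
  "run x ps = foldl (\<lambda>vs q. vs @ [operation_val x vs q]) [] ps"

definition expression_val :: "expression \<Rightarrow> (nat \<Rightarrow> real) \<Rightarrow> real" where
  "expression_val \<Phi> x = operand_val x (run x (operations \<Phi>)) (result \<Phi>)"

definition cost :: "expression \<Rightarrow> nat" where
  "cost \<Phi> = length (operations \<Phi>)"

fun operand_ok :: "nat \<Rightarrow> nat \<Rightarrow> operand \<Rightarrow> bool" where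
  "operand_ok d k (Coord i) \<longleftrightarrow> i < d"
| "operand_ok d k (Const c) \<longleftrightarrow> True"
| "operand_ok d k (Val j) \<longleftrightarrow> j < k"

fun operands :: "operation \<Rightarrow> operand set" where
  "operands (Add a b) = {a, b}"
| "operands (Sub a b) = {a, b}"
| "operands (Mul a b) = {a, b}"
| "operands (Div a b) = {a, b}"
| "operands (Max0 a) = {a}"
| "operands (Sin a) = {a}"
| "operands (Exp2 a) = {a}"

text \<open>
  \<open>finite_expression d S \<Phi>\<close>: \<open>\<Phi>\<close> is an expression in \<open>d\<close> input coordinates which refers only to
  earlier results and whose denominators do not vanish on the domain \<open>S\<close>.
\<close>

definition finite_expression :: "nat \<Rightarrow> (nat \<Rightarrow> real) set \<Rightarrow> expression \<Rightarrow> bool" where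
  "finite_expression d S \<Phi> \<longleftrightarrow>
     (\<forall>k<length (operations \<Phi>). \<forall>a\<in>operands (operations \<Phi> ! k). operand_ok d k a) \<and>
     operand_ok d (length (operations \<Phi>)) (result \<Phi>) \<and>
     (\<forall>x\<in>S. \<forall>k<length (operations \<Phi>). \<forall>a b. operations \<Phi> ! k = Div a b \<longrightarrow>
        operand_val x (run x (operations \<Phi>)) b \<noteq> 0)"

end

theory Submission
  imports Defs
begin

text \<open>
  The dictionary is so expressive that a single expression with \<open>O(d J)\<close> operations approximates
  every continuous function whose oscillation on cubes of side \<open>2 ^ (- J)\<close> is small: steep clamped
  sine waves extract the first \<open>J\<close> binary digits of each coordinate, outside a set of small measure,
  and one constant of the expression stores the table of values. So only a modulus of continuity
  of \<open>u d T\<close> is needed, and it may depend exponentially on \<open>d\<close>, since only \<open>J\<close>, the logarithm of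
  the mesh, enters the cost.

  The modulus comes from comparing \<open>u\<close> with its translate. No comparison principle between two
  viscosity solutions is needed: regard \<open>f (u t x)\<close> as a given source term. If source and initial value
  are replaced by trigonometric polynomials, the heat equation has an explicit classical solution,
  and viscosity solutions compare directly with classical functions.
\<close>

section \<open>Straight-line programs\<close>

text \<open>The obstacle is that the source \<open>f (u t x)\<close> contains the unknown: comparing
  \<open>u\<close> with its translate requires a bound on the very difference to be estimated.
  Polynomial growth gives a crude bound, which is then improved by iteration. All estimates are
  weighted, because the initial value is only locally Hoelder, with a constant that grows in space,
  and because maxima must be attained although space is unbounded. The weights are powers of 1 +
  |x|^2, propagated in time by an exponential whose rate is linear in \<open>d\<close>. On the unit
  cube the modulus at mesh \<open>2 ^ (- J)\<close> is therefore at most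
  \<open>exp (E * d - \<rho> * J * ln 2)\<close>, and \<open>J\<close> proportional to
  \<open>d / \<epsilon>\<close> makes this at most \<open>\<epsilon> / 4\<close>. Neither the
  steepness of the waves nor the base of the table has to be controlled: constants are free whatever
  their size. Hence the exceptional set is removed by dominated convergence, without a rate.\<close>

definition computes :: "nat \<Rightarrow> nat \<Rightarrow> ((nat \<Rightarrow> real) \<Rightarrow> real) \<Rightarrow> bool" where
  "computes d n F \<longleftrightarrow> (\<forall>ps. \<exists>qs a. length qs \<le> n \<and>
     (\<forall>k<length qs. (\<forall>c\<in>operands (qs ! k). operand_ok d (length ps + k) c) \<and>
        (\<forall>b c. qs ! k \<noteq> Div b c)) \<and>
     operand_ok d (length ps + length qs) a \<and>
     (\<forall>x. operand_val x (run x (ps @ qs)) a = F x))"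

lemma run_snoc: "run x (ps @ [q]) = run x ps @ [operation_val x (run x ps) q]"
  by (simp add: run_def)

lemma length_run [simp]: "length (run x ps) = length ps"
  by (induction ps rule: rev_induct) (simp_all add: run_snoc, simp add: run_def)

lemma run_append: "\<exists>vs. run x (ps @ qs) = run x ps @ vs"
proof (induction qs rule: rev_induct)
  case (snoc q qs)
  then show ?case by (metis append.assoc run_snoc)
qed simp

lemma operand_val_run_append:
  assumes "operand_ok d (length ps) a"
  shows "operand_val x (run x (ps @ qs)) a = operand_val x (run x ps) a"
proof -
  obtain vs where "run x (ps @ qs) = run x ps @ vs" using run_append by blast
  with assms show ?thesis by (cases a) (auto simp: nth_append)
qed

lemma operand_ok_mono: "operand_ok d k a \<Longrightarrow> k \<le> l \<Longrightarrow> operand_ok d l a"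
  by (cases a) auto

lemma computes_Const: "computes d 0 (\<lambda>x. c)"
  unfolding computes_def by (intro allI exI[of _ "[]"] exI[of _ "Const c"]) simp

lemma computes_Coord: "i < d \<Longrightarrow> computes d 0 (\<lambda>x. x i)"
  unfolding computes_def by (intro allI exI[of _ "[]"] exI[of _ "Coord i"]) simp

lemma computes_unary:
  assumes F: "computes d n F"
    and op: "\<And>a. operands (op a) = {a}" "\<And>a b c. op a \<noteq> Div b c"
    and val: "\<And>x vs a. operation_val x vs (op a) = G (operand_val x vs a)"
  shows "computes d (n + 1) (\<lambda>x. G (F x))"
  unfolding computes_def
proof
  fix ps
  obtain qs a where qs: "length qs \<le> n" "operand_ok d (length ps + length qs) a"
     "\<And>k. k < length qs \<Longrightarrow> (\<forall>c\<in>operands (qs ! k). operand_ok d (length ps + k) c) \<and>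
        (\<forall>b c. qs ! k \<noteq> Div b c)"
     "\<And>x. operand_val x (run x (ps @ qs)) a = F x"
    using F unfolding computes_def by metis
  have "operand_val x (run x (ps @ qs @ [op a])) (Val (length ps + length qs)) = G (F x)" for x
    using qs(4)[of x] run_snoc[of x "ps @ qs" "op a"] by (simp add: nth_append val)
  with qs op show "\<exists>qs a. length qs \<le> n + 1 \<and>
     (\<forall>k<length qs. (\<forall>c\<in>operands (qs ! k). operand_ok d (length ps + k) c) \<and>
        (\<forall>b c. qs ! k \<noteq> Div b c)) \<and>
     operand_ok d (length ps + length qs) a \<and>
     (\<forall>x. operand_val x (run x (ps @ qs)) a = G (F x))"
    by (intro exI[of _ "qs @ [op a]"] exI[of _ "Val (length ps + length qs)"])
       (auto simp: nth_append less_Suc_eq)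
qed

text \<open>The arbitrary prefix \<open>ps\<close> in \<open>computes\<close> makes this composition
  possible: the program for \<open>G\<close> is taken with prefix \<open>ps @ qs\<close>, so its
  references are numbered correctly from the start and no \<open>Val\<close> has to be
  renamed.\<close>

lemma computes_binary:
  assumes F: "computes d n F" and G: "computes d l G"
    and op: "\<And>a b. operands (op a b) = {a, b}" "\<And>a b b' c. op a b \<noteq> Div b' c"
    and val: "\<And>x vs a b. operation_val x vs (op a b) = H (operand_val x vs a) (operand_val x vs b)"
  shows "computes d (n + l + 1) (\<lambda>x. H (F x) (G x))"
  unfolding computes_def
proof
  fix ps
  obtain qs a where qs: "length qs \<le> n" "operand_ok d (length ps + length qs) a"
     "\<And>k. k < length qs \<Longrightarrow> (\<forall>c\<in>operands (qs ! k). operand_ok d (length ps + k) c) \<and>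
        (\<forall>b c. qs ! k \<noteq> Div b c)"
     "\<And>x. operand_val x (run x (ps @ qs)) a = F x"
    using F unfolding computes_def by metis
  obtain rs b where rs: "length rs \<le> l" "operand_ok d (length (ps @ qs) + length rs) b"
     "\<And>k. k < length rs \<Longrightarrow> (\<forall>c\<in>operands (rs ! k). operand_ok d (length (ps @ qs) + k) c) \<and>
        (\<forall>b c. rs ! k \<noteq> Div b c)"
     "\<And>x. operand_val x (run x ((ps @ qs) @ rs)) b = G x"
    using G unfolding computes_def by metis
  have "operand_val x (run x (ps @ qs @ rs @ [op a b])) (Val (length ps + length qs + length rs)) = H (F x) (G x)" for x
    using qs(4)[of x] rs(4)[of x] run_snoc[of x "ps @ qs @ rs" "op a b"]
      operand_val_run_append[of d "ps @ qs" a x rs] qs(2)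
    by (simp add: nth_append val)
  moreover have "operand_ok d (length ps + (length qs + length rs)) a"
    using qs(2) by (rule operand_ok_mono) simp
  ultimately show "\<exists>qs a. length qs \<le> n + l + 1 \<and>
     (\<forall>k<length qs. (\<forall>c\<in>operands (qs ! k). operand_ok d (length ps + k) c) \<and>
        (\<forall>b c. qs ! k \<noteq> Div b c)) \<and>
     operand_ok d (length ps + length qs) a \<and>
     (\<forall>x. operand_val x (run x (ps @ qs)) a = H (F x) (G x))"
    using qs(1-3) rs(1-3) op
    by (intro exI[of _ "qs @ rs @ [op a b]"] exI[of _ "Val (length ps + length qs + length rs)"])
       (force simp: nth_append less_Suc_eq add.assoc not_less le_Suc_ex dest!: le_Suc_ex)
qed

lemma computes_Max0: "computes d n F \<Longrightarrow> computes d (n + 1) (\<lambda>x. max 0 (F x))"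
  by (rule computes_unary[where op = Max0]) auto

lemma computes_Sin: "computes d n F \<Longrightarrow> computes d (n + 1) (\<lambda>x. sin (F x))"
  by (rule computes_unary[where op = Sin]) auto

lemma computes_Exp2: "computes d n F \<Longrightarrow> computes d (n + 1) (\<lambda>x. 2 powr F x)"
  by (rule computes_unary[where op = Exp2]) auto

lemma computes_Add: "computes d n F \<Longrightarrow> computes d l G \<Longrightarrow> computes d (n + l + 1) (\<lambda>x. F x + G x)"
  by (rule computes_binary[where op = Add]) auto

lemma computes_Sub: "computes d n F \<Longrightarrow> computes d l G \<Longrightarrow> computes d (n + l + 1) (\<lambda>x. F x - G x)"
  by (rule computes_binary[where op = Sub]) auto

lemma computes_Mul: "computes d n F \<Longrightarrow> computes d l G \<Longrightarrow> computes d (n + l + 1) (\<lambda>x. F x * G x)"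
  by (rule computes_binary[where op = Mul]) auto

lemma computes_scale: "computes d n F \<Longrightarrow> computes d (n + 1) (\<lambda>x. c * F x)"
  using computes_Mul[OF computes_Const] by fastforce

lemma computes_sum:
  "(\<And>m. m < N \<Longrightarrow> computes d n (F m)) \<Longrightarrow> computes d (N * (n + 1)) (\<lambda>x. \<Sum>m<N. F m x)"
proof (induction N)
  case 0
  show ?case using computes_Const by simp
next
  case (Suc N)
  have "computes d (N * (n + 1) + n + 1) (\<lambda>x. (\<Sum>m<N. F m x) + F N x)"
    by (intro computes_Add Suc) (auto intro: Suc)
  then show ?case by (simp add: algebra_simps)
qed

lemma computes_expression:
  assumes "computes d n F"
  obtains \<Psi> where "finite_expression d S \<Psi>" "cost \<Psi> \<le> n" "expression_val \<Psi> = F"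
proof -
  obtain qs a where qs: "length qs \<le> n" "operand_ok d (length qs) a"
     "\<And>k. k < length qs \<Longrightarrow> (\<forall>c\<in>operands (qs ! k). operand_ok d k c) \<and> (\<forall>b c. qs ! k \<noteq> Div b c)"
     "\<And>x. operand_val x (run x qs) a = F x"
    using assms unfolding computes_def by (auto dest!: spec[of _ "[]"])
  then show thesis
    by (intro that[of "Expression qs a"]) (auto simp: finite_expression_def cost_def expression_val_def)
qed

section \<open>Table lookup and binary digits\<close>

lemma abs_sin_diff_le: "\<bar>sin x - sin y\<bar> \<le> \<bar>x - y :: real\<bar>"
proof -
  have "\<bar>sin x - sin y\<bar> = 2 * \<bar>sin ((x - y) / 2)\<bar> * \<bar>cos ((x + y) / 2)\<bar>"
    by (simp add: sin_diff_sin abs_mult)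
  also have "\<dots> \<le> 2 * \<bar>(x - y) / 2\<bar> * 1"
    by (intro mult_mono abs_sin_x_le_abs_x) auto
  finally show ?thesis by simp
qed

text \<open>
  The table is stored in the base-\<open>B\<close> digits of a single constant: multiplication by \<open>B ^ k\<close> shifts
  digit number \<open>k\<close> to the front, and the periodicity of the sine discards the digits before it.
\<close>

lemma lookup_exists:
  fixes y :: "nat \<Rightarrow> real"
  assumes "\<And>k. \<bar>y k\<bar> \<le> 1" and "0 < \<epsilon>"
  obtains a b where "\<And>k::nat. k < M \<Longrightarrow> \<bar>sin (a * 2 powr (b * real k)) - y k\<bar> \<le> \<epsilon>"
proof -
  obtain B0 :: nat where B0: "4 * pi / \<epsilon> < real B0" using reals_Archimedean2 by blast
  \<comment> \<open>\<open>B0\<close> makes the phase error \<open>2 * pi * (2 / B)\<close> at most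
    \<epsilon>; the lower bound 4 keeps the new constant in \<open>[-1, 1]\<close>, since 1/4 + 2/B
    \<le> 1.\<close>
  define B where "B = max B0 4"
  have B4: "4 \<le> real B" and Be: "4 * pi / B \<le> \<epsilon>" 
  proof -
    have "4 * pi / \<epsilon> \<le> B" using B0 by (simp add: B_def)
    moreover show "4 \<le> real B" by (simp add: B_def)
    ultimately show "4 * pi / B \<le> \<epsilon>" using \<open>0 < \<epsilon>\<close> by (simp add: field_simps)
  qed
  \<comment> \<open>The bound on \<mu> is carried along because \<mu> / B is the disturbance that
    the later entries cause in the phase of the first one.\<close>
  have "\<exists>\<mu>. \<bar>\<mu>\<bar> \<le> 1 \<and> (\<forall>k<M. \<bar>sin (2 * pi * \<mu> * real B ^ k) - y k\<bar> \<le> \<epsilon>)"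
    using assms(1)
  proof (induction M arbitrary: y)
    case 0
    show ?case by (intro exI[of _ 0]) simp
  next
    case (Suc M)
    obtain \<mu> where \<mu>: "\<bar>\<mu>\<bar> \<le> 1" "\<And>k. k < M \<Longrightarrow> \<bar>sin (2 * pi * \<mu> * real B ^ k) - y (Suc k)\<bar> \<le> \<epsilon>"
      using Suc.IH[of "\<lambda>k. y (Suc k)"] Suc.prems by auto
    \<comment> \<open>\<theta> is the phase that produces the first entry exactly; \<open>a\<close>
      rounds \<open>B * \<theta>\<close> to an integer, and \<open>(a + \<mu>) / B\<close> puts
      \<open>a\<close> in front of the digits of \<mu>.\<close>
    define \<theta> where "\<theta> = arcsin (y 0) / (2 * pi)"
    have y0: "-1 \<le> y 0" "y 0 \<le> 1" using Suc.prems[of 0] by auto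
    have s\<theta>: "sin (2 * pi * \<theta>) = y 0" using y0 by (simp add: \<theta>_def)
    have \<theta>4: "\<bar>\<theta>\<bar> \<le> 1/4"
      using arcsin_lbound[OF y0] arcsin_ubound[OF y0] by (auto simp: \<theta>_def field_simps abs_le_iff)
    define a where "a = \<lfloor>B * \<theta>\<rfloor>"
    have a: "\<bar>a - B * \<theta>\<bar> \<le> 1" unfolding a_def by linarith
    define \<nu> where "\<nu> = (a + \<mu>) / B"
    have \<nu>\<theta>: "\<bar>\<nu> - \<theta>\<bar> \<le> 2 / B"
    proof -
      have "\<nu> - \<theta> = (a - B * \<theta> + \<mu>) / B" using B4 by (simp add: \<nu>_def field_simps)
      also have "\<bar>\<dots>\<bar> \<le> 2 / B" using a \<mu>(1) B4 by (simp add: abs_divide divide_right_mono)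
      finally show ?thesis .
    qed
    have "2 / B \<le> 1/2" using B4 by (simp add: field_simps)
    then have "\<bar>\<nu>\<bar> \<le> 1" using \<nu>\<theta> \<theta>4 by linarith
    moreover have "\<bar>sin (2 * pi * \<nu> * real B ^ k) - y k\<bar> \<le> \<epsilon>" if "k < Suc M" for k
    proof (cases k)
      case 0
      have "\<bar>sin (2 * pi * \<nu>) - sin (2 * pi * \<theta>)\<bar> \<le> \<bar>2 * pi * \<nu> - 2 * pi * \<theta>\<bar>"
        by (rule abs_sin_diff_le)
      also have "\<dots> = 2 * pi * \<bar>\<nu> - \<theta>\<bar>" by (simp add: abs_mult flip: right_diff_distrib)
      also have "\<dots> \<le> 2 * pi * (2 / B)" using \<nu>\<theta> by (intro mult_left_mono) auto
      also have "\<dots> \<le> \<epsilon>" using Be by (simp add: field_simps)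
      finally show ?thesis using 0 s\<theta> by simp
    next
      case (Suc j)
      have "2 * pi * \<nu> * real B ^ k = 2 * pi * \<mu> * real B ^ j + 2 * pi * of_int (a * int B ^ j)"
        using B4 Suc by (simp add: \<nu>_def field_simps)
      then have "sin (2 * pi * \<nu> * real B ^ k) = sin (2 * pi * \<mu> * real B ^ j)"
        by (simp only: sin_add sin_int_2pin cos_int_2pin)
      then show ?thesis using \<mu>(2)[of j] Suc that by simp
    qed
    ultimately show ?case by blast
  qed
  then obtain \<mu> where \<mu>: "\<And>k. k < M \<Longrightarrow> \<bar>sin (2 * pi * \<mu> * real B ^ k) - y k\<bar> \<le> \<epsilon>"
    by blast
  have "2 powr (log 2 B * real k) = real B ^ k" for k
    using B4 by (simp add: powr_powr[symmetric] powr_realpow)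
  with \<mu> show thesis by (intro that[of "2 * pi * \<mu>" "log 2 B"]) simp
qed

section \<open>Binary digits and the points they determine\<close>

lemma binary_sum_less: "(\<Sum>m<n. 2 ^ m * of_bool (P m)) < (2::nat) ^ n"
  by (induction n) auto

lemma binary_sum_inject:
  fixes n :: nat
  assumes "(\<Sum>m<n. 2 ^ m * of_bool (P m)) = (\<Sum>m<n. (2::nat) ^ m * of_bool (Q m))" and "m < n"
  shows "P m = Q m"
  using assms
proof (induction n)
  case (Suc n)
  have *: "P n = Q n"
    using Suc.prems(1) binary_sum_less[of P n] binary_sum_less[of Q n] by (cases "P n"; cases "Q n") auto
  then show ?case using Suc by (auto simp: less_Suc_eq)
qed simp

text \<open>Off its zeros, which are dyadic points, the wave number \<open>j\<close> is negative
  exactly if the fractional part of \<open>2 ^ j * x\<close> exceeds 1/2, that is, if binary digit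
  \<open>j + 1\<close> of \<open>x\<close> is 1. The induction strips the first digit by the
  doubling map.\<close>

lemma binary_digits_close:
  fixes x y :: real
  assumes "0 \<le> x" "x \<le> 1" "0 \<le> y" "y \<le> 1"
    and "\<And>j. j < J \<Longrightarrow> sin (2 * pi * 2 ^ j * x) \<noteq> 0"
    and "\<And>j. j < J \<Longrightarrow> sin (2 * pi * 2 ^ j * y) \<noteq> 0"
    and "\<And>j. j < J \<Longrightarrow> (sin (2 * pi * 2 ^ j * x) < 0) = (sin (2 * pi * 2 ^ j * y) < 0)"
  shows "\<bar>x - y\<bar> \<le> 1 / 2 ^ J"
  using assms
proof (induction J arbitrary: x y)
  case (Suc J)
  have half: "z \<le> 1/2" if "0 < sin (2 * pi * z)" "z \<le> 1" for z :: real
  proof (rule ccontr)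
    assume "\<not> z \<le> 1/2"
    then have "0 \<le> 2 * pi * z - pi" "2 * pi * z - pi \<le> pi" using that by (auto simp: field_simps)
    then have "0 \<le> sin (2 * pi * z - pi)" by (rule sin_ge_zero)
    then have "sin (2 * pi * z) \<le> 0" by simp
    then show False using that by simp
  qed
  have half': "1/2 \<le> z" if "sin (2 * pi * z) < 0" "0 \<le> z" for z :: real
  proof (rule ccontr)
    assume "\<not> 1/2 \<le> z"
    then have "0 \<le> 2 * pi * z" "2 * pi * z \<le> pi" using that by (auto simp: field_simps)
    then have "0 \<le> sin (2 * pi * z)" by (rule sin_ge_zero)
    then show False using that by simp
  qed
  have shift: "sin (2 * pi * 2 ^ j * (2 * z - c)) = sin (2 * pi * 2 ^ Suc j * z)"
    if "c = 0 \<or> c = 1" for j and z c :: real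
  proof -
    have "2 * pi * 2 ^ j * (2 * z - c) = 2 * pi * 2 ^ Suc j * z - 2 * pi * of_int (2 ^ j * \<lfloor>c\<rfloor>)"
      using that by (auto simp: algebra_simps)
    then show ?thesis by (simp only: sin_diff sin_int_2pin cos_int_2pin)
  qed
  \<comment> \<open>\<open>c\<close> is the common first digit of both points; passing from
    \<open>z\<close> to \<open>2 * z - c\<close> shifts the digits by one and doubles the
    distance.\<close>
  define c :: real where "c = of_bool (sin (2 * pi * x) < 0)"
  have c: "c = 0 \<or> c = 1" by (simp add: c_def)
  have bx: "0 \<le> 2 * x - c" "2 * x - c \<le> 1"
    using half[of x] half'[of x] Suc.prems(1,2) Suc.prems(5)[of 0] by (auto simp: c_def)
  have by0: "0 \<le> 2 * y - c" "2 * y - c \<le> 1"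
    using half[of y] half'[of y] Suc.prems(3,4) Suc.prems(6)[of 0] Suc.prems(7)[of 0] by (auto simp: c_def)
  have "\<bar>(2 * x - c) - (2 * y - c)\<bar> \<le> 1 / 2 ^ J"
    using Suc.prems(5-7)[of "Suc _"]
    by (intro Suc.IH bx by0) (simp_all add: shift[OF c] del: power_Suc)
  then show ?case by (simp add: field_simps abs_le_iff)
qed auto

section \<open>Classical functions\<close>

text \<open>The squared norm is used instead of the norm so that powers of the weight are smooth;
  the summand 1 makes them increase with the exponent.\<close>

definition weight :: "nat \<Rightarrow> (nat \<Rightarrow> real) \<Rightarrow> real" where
  "weight d x = 1 + (\<Sum>i<d. (x i)\<^sup>2)"

definition box_Rd :: "nat \<Rightarrow> real \<Rightarrow> (nat \<Rightarrow> real) set" where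
  "box_Rd d R = {x \<in> Rd d. \<forall>i<d. \<bar>x i\<bar> \<le> R}"

lemma continuous_on_coord [continuous_intros]: "continuous_on S (\<lambda>x::nat \<Rightarrow> real. x i)"
  by (rule continuous_on_subset[OF continuous_on_product_coordinates subset_UNIV])

lemma continuous_on_snd_coord [continuous_intros]:
  "continuous_on S (\<lambda>z::real \<times> (nat \<Rightarrow> real). snd z i)"
  by (rule continuous_on_product_then_coordinatewise) (intro continuous_intros)

text \<open>Points of \<open>Rd d\<close> equal \<open>undefined\<close> off \<open>{..<d}\<close>,
  so the box is a product over all of \<open>nat\<close> with singleton factors there, and
  Tychonoff's theorem applies.\<close>

lemma compact_box_Rd: "compact (box_Rd d R)"
proof -
  have "box_Rd d R = (\<Pi>\<^sub>E i\<in>UNIV. if i < d then {-R..R} else {undefined})"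
    unfolding box_Rd_def Rd_def PiE_def extensional_def Pi_def by (auto simp: abs_le_iff split: if_splits)
  moreover have "compactin (product_topology (\<lambda>_. euclidean) UNIV) \<dots>"
    unfolding compactin_PiE by auto
  ultimately show ?thesis
    by (metis compactin_euclidean_iff euclidean_product_topology)
qed

lemma weight_ge_1: "1 \<le> weight d x"
  by (simp add: weight_def sum_nonneg)

lemma weight_pos: "0 < weight d x"
  using weight_ge_1[of d x] by linarith

lemma coord_sq_le_weight: "i < d \<Longrightarrow> (x i)\<^sup>2 \<le> weight d x"
  unfolding weight_def by (rule order_trans[OF member_le_sum[of i "{..<d}" "\<lambda>i. (x i)\<^sup>2"]]) auto

lemma weight_large: "\<exists>R>0. \<forall>x\<in>Rd d. x \<notin> box_Rd d R \<longrightarrow> c \<le> weight d x"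
proof (intro exI[of _ "max 1 c"] conjI ballI impI)
  fix x assume "x \<in> Rd d" "x \<notin> box_Rd d (max 1 c)"
  then obtain i where i: "i < d" "max 1 c < \<bar>x i\<bar>" by (auto simp: box_Rd_def not_le)
  have "c \<le> max 1 c * max 1 c" by (rule order_trans[of _ "max 1 c * 1"], simp, intro mult_left_mono) auto
  also have "\<dots> \<le> \<bar>x i\<bar> * \<bar>x i\<bar>" using i by (intro mult_mono) auto
  also have "\<dots> \<le> weight d x" using coord_sq_le_weight[OF i(1), of x] by (simp add: power2_eq_square)
  finally show "c \<le> weight d x" .
qed simp

lemma C12_add:
  assumes "C12 T d \<phi> \<phi>t D1 D2" "C12 T d \<psi> \<psi>t E1 E2"
  shows "C12 T d (\<lambda>t x. \<phi> t x + \<psi> t x) (\<lambda>t x. \<phi>t t x + \<psi>t t x)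
    (\<lambda>i t x. D1 i t x + E1 i t x) (\<lambda>i j t x. D2 i j t x + E2 i j t x)"
  using assms unfolding C12_def case_prod_beta' by (auto intro!: continuous_intros DERIV_add)

lemma C12_cmult:
  assumes "C12 T d \<phi> \<phi>t D1 D2"
  shows "C12 T d (\<lambda>t x. c * \<phi> t x) (\<lambda>t x. c * \<phi>t t x) (\<lambda>i t x. c * D1 i t x) (\<lambda>i j t x. c * D2 i j t x)"
  using assms unfolding C12_def case_prod_beta' by (auto intro!: continuous_intros DERIV_cmult)

text \<open>All concrete test functions below are sums of such products: barriers, Fourier modes,
  and a time penalty with constant spatial factor.\<close>

lemma C12_separated:
  assumes r: "\<And>t. t \<in> {0<..<T} \<Longrightarrow> (r has_real_derivative r' t) (at t)" "continuous_on {0<..<T} r'"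
    and c: "continuous_on (Rd d) s" "\<And>i. i < d \<Longrightarrow> continuous_on (Rd d) (s1 i)"
       "\<And>i j. i < d \<Longrightarrow> j < d \<Longrightarrow> continuous_on (Rd d) (s2 i j)"
    and s1: "\<And>x i. i < d \<Longrightarrow> x \<in> Rd d \<Longrightarrow> ((\<lambda>y. s (x(i := y))) has_real_derivative s1 i x) (at (x i))"
    and s2: "\<And>x i j. i < d \<Longrightarrow> j < d \<Longrightarrow> x \<in> Rd d \<Longrightarrow>
       ((\<lambda>y. s1 i (x(j := y))) has_real_derivative s2 i j x) (at (x j))"
  shows "C12 T d (\<lambda>t x. r t * s x) (\<lambda>t x. r' t * s x) (\<lambda>i t x. r t * s1 i x) (\<lambda>i j t x. r t * s2 i j x)"
proof -
  have r_cont: "continuous_on {0<..<T} r"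
    using r(1) by (meson DERIV_continuous_on has_field_derivative_at_within)
  have prod: "continuous_on ({0<..<T} \<times> Rd d) (\<lambda>z. \<rho> (fst z) * \<sigma> (snd z))"
    if "continuous_on {0<..<T} \<rho>" "continuous_on (Rd d) \<sigma>" for \<rho> :: "real \<Rightarrow> real" and \<sigma>
    using that by (intro continuous_on_mult continuous_on_compose2[OF that(1)] continuous_on_compose2[OF that(2)]
        continuous_intros) auto
  show ?thesis
    unfolding C12_def case_prod_beta'
    using r r_cont c s1 s2 by (auto intro!: prod DERIV_cmult DERIV_cmult_right)
qed

text \<open>Comparison sees the derivatives of a classical function only through the time derivative
  minus the Laplacian. Hiding the derivatives themselves turns linearity into plain rules.\<close>

definition heat_op ::
  "real \<Rightarrow> nat \<Rightarrow> (real \<Rightarrow> (nat \<Rightarrow> real) \<Rightarrow> real) \<Rightarrow> (real \<Rightarrow> (nat \<Rightarrow> real) \<Rightarrow> real) \<Rightarrow> bool" where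
  "heat_op T d v H \<longleftrightarrow> continuous_on ({0..T} \<times> Rd d) (\<lambda>(t, x). v t x) \<and>
     (\<exists>vt D1 D2. C12 T d v vt D1 D2 \<and>
       (\<forall>t\<in>{0<..<T}. \<forall>x\<in>Rd d. H t x = vt t x - (\<Sum>i<d. D2 i i t x)))"

lemma heat_op_continuous:
  "heat_op T d v H \<Longrightarrow> continuous_on ({0..T} \<times> Rd d) (\<lambda>z. v (fst z) (snd z))"
  unfolding heat_op_def case_prod_beta' by blast

lemma heat_op_add:
  assumes "heat_op T d v H" "heat_op T d w K"
  shows "heat_op T d (\<lambda>t x. v t x + w t x) (\<lambda>t x. H t x + K t x)"
proof -
  obtain vt D1 D2 where v: "C12 T d v vt D1 D2"
    "\<forall>t\<in>{0<..<T}. \<forall>x\<in>Rd d. H t x = vt t x - (\<Sum>i<d. D2 i i t x)"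
    using assms(1) unfolding heat_op_def by blast
  obtain wt E1 E2 where w: "C12 T d w wt E1 E2"
    "\<forall>t\<in>{0<..<T}. \<forall>x\<in>Rd d. K t x = wt t x - (\<Sum>i<d. E2 i i t x)"
    using assms(2) unfolding heat_op_def by blast
  have "continuous_on ({0..T} \<times> Rd d) (\<lambda>(t, x). v t x + w t x)"
    unfolding case_prod_beta' by (intro continuous_intros assms[THEN heat_op_continuous])
  moreover have "\<forall>t\<in>{0<..<T}. \<forall>x\<in>Rd d. H t x + K t x =
      vt t x + wt t x - (\<Sum>i<d. D2 i i t x + E2 i i t x)"
    using v(2) w(2) by (simp add: sum.distrib)
  ultimately show ?thesis
    using C12_add[OF v(1) w(1)] unfolding heat_op_def by blast
qed

lemma heat_op_cmult:
  assumes "heat_op T d v H"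
  shows "heat_op T d (\<lambda>t x. c * v t x) (\<lambda>t x. c * H t x)"
proof -
  obtain vt D1 D2 where v: "C12 T d v vt D1 D2"
    "\<forall>t\<in>{0<..<T}. \<forall>x\<in>Rd d. H t x = vt t x - (\<Sum>i<d. D2 i i t x)"
    using assms unfolding heat_op_def by blast
  have "continuous_on ({0..T} \<times> Rd d) (\<lambda>(t, x). c * v t x)"
    unfolding case_prod_beta' by (intro continuous_intros assms[THEN heat_op_continuous])
  moreover have "\<forall>t\<in>{0<..<T}. \<forall>x\<in>Rd d. c * H t x = c * vt t x - (\<Sum>i<d. c * D2 i i t x)"
    using v(2) by (simp add: right_diff_distrib sum_distrib_left)
  ultimately show ?thesis
    using C12_cmult[OF v(1)] unfolding heat_op_def by blast
qed

section \<open>Barriers: weights propagated in time\<close>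

definition barrier :: "nat \<Rightarrow> nat \<Rightarrow> real \<Rightarrow> real \<Rightarrow> (nat \<Rightarrow> real) \<Rightarrow> real" where
  "barrier d q \<Lambda> t x = exp ((\<Lambda> + 4 * (real q)\<^sup>2 + 2 * real d * real q) * t) * weight d x ^ q"

lemma barrier_ge: "0 \<le> \<Lambda> \<Longrightarrow> 0 \<le> t \<Longrightarrow> weight d x ^ q \<le> barrier d q \<Lambda> t x"
  unfolding barrier_def using weight_pos[of d x] by (intro mult_le_cancel_right1[THEN iffD2]) auto

lemma barrier_pos: "0 < barrier d q \<Lambda> t x"
  unfolding barrier_def using weight_pos[of d x] by simp

lemma weight_has_derivative:
  assumes "i < d"
  shows "((\<lambda>y. weight d (x(i := y))) has_real_derivative 2 * x i) (at (x i))"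
proof -
  have *: "weight d (x(i := y)) = 1 + (\<Sum>j\<in>{..<d} - {i}. (x j)\<^sup>2) + y\<^sup>2" for y
  proof -
    have "(\<Sum>j<d. ((x(i := y)) j)\<^sup>2) = y\<^sup>2 + (\<Sum>j\<in>{..<d} - {i}. ((x(i := y)) j)\<^sup>2)"
      using assms by (subst sum.remove[of _ i]) auto
    also have "(\<Sum>j\<in>{..<d} - {i}. ((x(i := y)) j)\<^sup>2) = (\<Sum>j\<in>{..<d} - {i}. (x j)\<^sup>2)"
      by (rule sum.cong) auto
    finally show ?thesis by (simp add: weight_def)
  qed
  show ?thesis unfolding * by (auto intro!: derivative_eq_intros)
qed

lemma continuous_on_weight [continuous_intros]: "continuous_on S (weight d)"
  unfolding weight_def by (intro continuous_intros)

text \<open>With w = \<open>weight d x\<close>, the Laplacian of w^q is 4 q (q - 1) |x|^2 w^(q-2) +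
  2 d q w^(q-1), hence at most (4 q^2 + 2 d q) w^q. The exponential rate in \<open>barrier\<close>
  exceeds this coefficient by \<Lambda>.\<close>

lemma heat_op_barrier:
  "\<exists>H. heat_op T d (barrier d q \<Lambda>) H \<and> (\<forall>t. \<forall>x. \<Lambda> * barrier d q \<Lambda> t x \<le> H t x)"
proof -
  define l where "l = \<Lambda> + 4 * (real q)\<^sup>2 + 2 * real d * real q"
  define s1 where "s1 = (\<lambda>i x. real q * weight d x ^ (q - 1) * (2 * x i))"
  define s2 where "s2 = (\<lambda>i j x. real q * (real (q - 1) * weight d x ^ (q - 1 - 1) * (2 * x j)) * (2 * x i)
       + (if i = j then real q * weight d x ^ (q - 1) * 2 else 0))"
  have barrier_eq: "barrier d q \<Lambda> = (\<lambda>t x. exp (l * t) * weight d x ^ q)"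
    by (simp add: barrier_def l_def fun_eq_iff)
  have C: "C12 T d (barrier d q \<Lambda>) (\<lambda>t x. (l * exp (l * t)) * weight d x ^ q)
     (\<lambda>i t x. exp (l * t) * s1 i x) (\<lambda>i j t x. exp (l * t) * s2 i j x)"
    unfolding barrier_eq
  proof (rule C12_separated)
    fix x :: "nat \<Rightarrow> real" and i assume i: "i < d"
    show "((\<lambda>y. weight d (x(i := y)) ^ q) has_real_derivative s1 i x) (at (x i))"
      unfolding s1_def using DERIV_power[OF weight_has_derivative[OF i, of x], of q]
      by (simp add: algebra_simps)
    fix j assume j: "j < d"
    have *: "((\<lambda>y. real q * weight d (x(j := y)) ^ (q - 1)) has_real_derivative
       real q * (real (q - 1) * weight d x ^ (q - 1 - 1) * (2 * x j))) (at (x j))"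
      using DERIV_cmult[OF DERIV_power[OF weight_has_derivative[OF j, of x], of "q - 1"], of "real q"]
      by (simp add: algebra_simps)
    have **: "((\<lambda>y. 2 * (x(j := y)) i) has_real_derivative (if i = j then 2 else 0)) (at (x j))"
      by (cases "i = j") (auto intro!: derivative_eq_intros)
    show "((\<lambda>y. s1 i (x(j := y))) has_real_derivative s2 i j x) (at (x j))"
      unfolding s1_def s2_def using DERIV_mult[OF * **] 
      by (rule DERIV_cong) auto
    show "continuous_on (Rd d) (s2 i j)"
      unfolding s2_def by (cases "i = j") (auto intro!: continuous_intros)
  qed (auto intro!: derivative_eq_intros continuous_intros simp: s1_def)
  have lap: "(\<Sum>i<d. s2 i i x) \<le> (4 * (real q)\<^sup>2 + 2 * real d * real q) * weight d x ^ q" for x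
  proof -
    have "s2 i i x = real q * real (q - 1) * weight d x ^ (q - 1 - 1) * 4 * (x i)\<^sup>2
       + real q * weight d x ^ (q - 1) * 2" for i
      by (simp add: s2_def power2_eq_square)
    then have "(\<Sum>i<d. s2 i i x) = real q * real (q - 1) * weight d x ^ (q - 1 - 1) * 4 * (\<Sum>i<d. (x i)\<^sup>2)
       + real d * (real q * weight d x ^ (q - 1) * 2)"
      by (simp add: sum.distrib flip: sum_distrib_left)
    \<comment> \<open>For \<open>q \<le> 1\<close> the coefficient
      \<open>real q * real (q - 1)\<close> vanishes, so the truncated exponent
      \<open>q - 1 - 1\<close> does no harm.\<close>
    also have "real q * real (q - 1) * weight d x ^ (q - 1 - 1) * 4 * (\<Sum>i<d. (x i)\<^sup>2)
        \<le> 4 * (real q)\<^sup>2 * weight d x ^ q"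
    proof (cases "q \<le> 1")
      case False
      then have "weight d x ^ q = weight d x ^ (q - 1 - 1) * weight d x * weight d x"
        by (metis One_nat_def Suc_diff_Suc diff_Suc_eq_diff_pred diff_zero mult.assoc mult.commute
            not_le order.strict_trans zero_less_one power_Suc)
      moreover have "(\<Sum>i<d. (x i)\<^sup>2) \<le> weight d x * weight d x"
        using mult_mono[of 1 "weight d x" "\<Sum>i<d. (x i)\<^sup>2" "weight d x"] weight_ge_1[of d x]
        by (auto simp: weight_def sum_nonneg)
      ultimately have "weight d x ^ (q - 1 - 1) * (\<Sum>i<d. (x i)\<^sup>2) \<le> weight d x ^ q"
        using weight_pos[of d x] by (simp add: mult.assoc mult_left_mono)
      moreover have "real q * real (q - 1) \<le> (real q)\<^sup>2"
        unfolding power2_eq_square by (intro mult_left_mono) auto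
      ultimately have "(real q * real (q - 1)) * (weight d x ^ (q - 1 - 1) * (\<Sum>i<d. (x i)\<^sup>2))
          \<le> (real q)\<^sup>2 * weight d x ^ q"
        using weight_pos[of d x] by (intro mult_mono) (auto simp: sum_nonneg)
      then show ?thesis by (simp add: algebra_simps)
    qed (use weight_pos[of d x] in \<open>auto simp: le_Suc_eq\<close>)
    also have "real d * (real q * weight d x ^ (q - 1) * 2) \<le> 2 * real d * real q * weight d x ^ q"
      using power_increasing[OF _ weight_ge_1, of "q - 1" q d x]
      by (simp add: mult_left_mono algebra_simps)
    finally show ?thesis by (simp add: algebra_simps)
  qed
  have le: "\<Lambda> * barrier d q \<Lambda> t x \<le> (l * exp (l * t)) * weight d x ^ q - (\<Sum>i<d. exp (l * t) * s2 i i x)" for t x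
  proof -
    have "exp (l * t) * (\<Sum>i<d. s2 i i x) \<le> exp (l * t) * ((l - \<Lambda>) * weight d x ^ q)"
      using lap[of x] by (intro mult_left_mono) (auto simp: l_def)
    then show ?thesis unfolding barrier_eq by (simp add: sum_distrib_left algebra_simps)
  qed
  have "continuous_on ({0..T} \<times> Rd d) (\<lambda>(t, x). barrier d q \<Lambda> t x)"
    unfolding barrier_eq case_prod_beta' weight_def by (intro continuous_intros)
  then have "heat_op T d (barrier d q \<Lambda>)
      (\<lambda>t x. (l * exp (l * t)) * weight d x ^ q - (\<Sum>i<d. exp (l * t) * s2 i i x))"
    unfolding heat_op_def using C by blast
  with le show ?thesis by blast
qed

section \<open>Comparison of a viscosity subsolution with a classical supersolution\<close>

text \<open>
  Testing only at global maxima is weaker than the viscosity property. It suffices for the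
  comparison, and it avoids translating neighbourhood filters.
\<close>

definition global_subsolution ::
  "real \<Rightarrow> nat \<Rightarrow> (real \<Rightarrow> (nat \<Rightarrow> real) \<Rightarrow> real) \<Rightarrow> (real \<Rightarrow> (nat \<Rightarrow> real) \<Rightarrow> real) \<Rightarrow> bool" where
  "global_subsolution T d u F \<longleftrightarrow>
     (\<forall>\<phi> \<phi>t D1 D2. C12 T d \<phi> \<phi>t D1 D2 \<longrightarrow> (\<forall>t\<in>{0<..<T}. \<forall>x\<in>Rd d.
        (\<forall>s\<in>{0<..<T}. \<forall>y\<in>Rd d. u s y - \<phi> s y \<le> u t x - \<phi> t x) \<longrightarrow>
        \<phi>t t x \<le> (\<Sum>i<d. D2 i i t x) + F t x))"

lemma eventually_at_within_Times:
  "(\<And>s y. s \<in> A \<Longrightarrow> y \<in> B \<Longrightarrow> P s y) \<Longrightarrow> \<forall>\<^sub>F (s, y) in at z within A \<times> B. P s y"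
  unfolding eventually_at_filter by (rule always_eventually) auto

lemma global_subsolution_if_viscosity:
  assumes "viscosity_subsolution T d f u"
  shows "global_subsolution T d u (\<lambda>t x. f (u t x))"
  unfolding global_subsolution_def
proof (intro allI impI ballI)
  fix \<phi> \<phi>t D1 D2 t x
  assume C: "C12 T d \<phi> \<phi>t D1 D2" and t: "t \<in> {0<..<T}" and x: "x \<in> Rd d"
    and max: "\<forall>s\<in>{0<..<T}. \<forall>y\<in>Rd d. u s y - \<phi> s y \<le> u t x - \<phi> t x"
  have "\<forall>\<^sub>F (s, y) in at (t, x) within {0<..<T} \<times> Rd d. u s y - \<phi> s y \<le> u t x - \<phi> t x"
    by (rule eventually_at_within_Times) (use max in force)
  then show "\<phi>t t x \<le> (\<Sum>i<d. D2 i i t x) + f (u t x)"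
    using assms C t x unfolding viscosity_subsolution_def by blast
qed

lemma global_subsolution_neg_if_viscosity:
  assumes "viscosity_supersolution T d f u"
  shows "global_subsolution T d (\<lambda>t x. - u t x) (\<lambda>t x. - f (u t x))"
  unfolding global_subsolution_def
proof (intro allI impI ballI)
  fix \<phi> \<phi>t D1 D2 t x
  assume C: "C12 T d \<phi> \<phi>t D1 D2" and t: "t \<in> {0<..<T}" and x: "x \<in> Rd d"
    and max: "\<forall>s\<in>{0<..<T}. \<forall>y\<in>Rd d. - u s y - \<phi> s y \<le> - u t x - \<phi> t x"
  have "\<forall>\<^sub>F (s, y) in at (t, x) within {0<..<T} \<times> Rd d. u s y - -1 * \<phi> s y \<ge> u t x - -1 * \<phi> t x"
    by (rule eventually_at_within_Times) (use max in force)
  then have "-1 * \<phi>t t x \<ge> (\<Sum>i<d. -1 * D2 i i t x) + f (u t x)"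
    using assms C12_cmult[OF C, of "-1"] t x unfolding viscosity_supersolution_def by blast
  then show "\<phi>t t x \<le> (\<Sum>i<d. D2 i i t x) + - f (u t x)"
    by (simp add: sum_negf)
qed

text \<open>Since \<phi> is classical, it enters the test function itself and no doubling of
  variables is needed. If \<open>u - \<phi>\<close> were positive somewhere before \<open>T\<close>,
  then subtracting a penalty that blows up at \<open>T\<close> would give a global maximum at an
  interior time and inside the box. There the subsolution inequality contradicts
  \<open>F < H\<close>, as the penalty increases in time.\<close>

lemma comparison:
  assumes T: "0 < T" and sub: "global_subsolution T d u F"
    and u: "continuous_on ({0..T} \<times> Rd d) (\<lambda>(t, x). u t x)"
    and \<phi>: "heat_op T d \<phi> H"
    and strict: "\<And>t x. t \<in> {0<..<T} \<Longrightarrow> x \<in> Rd d \<Longrightarrow> F t x < H t x"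
    and init: "\<And>x. x \<in> Rd d \<Longrightarrow> u 0 x \<le> \<phi> 0 x"
    and far: "\<And>t x. t \<in> {0..T} \<Longrightarrow> x \<in> Rd d \<Longrightarrow> x \<notin> box_Rd d R \<Longrightarrow> u t x \<le> \<phi> t x"
    and t: "t \<in> {0..T}" and x: "x \<in> Rd d"
  shows "u t x \<le> \<phi> t x"
proof -
  obtain \<phi>t D1 D2 where C: "C12 T d \<phi> \<phi>t D1 D2"
    and H: "\<And>t x. t \<in> {0<..<T} \<Longrightarrow> x \<in> Rd d \<Longrightarrow> H t x = \<phi>t t x - (\<Sum>i<d. D2 i i t x)"
    and \<phi>_cont: "continuous_on ({0..T} \<times> Rd d) (\<lambda>(t, x). \<phi> t x)"
    using \<phi> unfolding heat_op_def by metis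
  have diff_cont: "continuous_on ({0..T} \<times> Rd d) (\<lambda>z. u (fst z) (snd z) - \<phi> (fst z) (snd z))"
    using u \<phi>_cont unfolding case_prod_beta' by (intro continuous_intros)
  have box: "box_Rd d R \<subseteq> Rd d" by (auto simp: box_Rd_def)
  have before_T: "u t0 x0 \<le> \<phi> t0 x0" if t0: "0 \<le> t0" "t0 < T" and x0: "x0 \<in> Rd d" for t0 x0
  proof (rule ccontr)
    assume neg: "\<not> u t0 x0 \<le> \<phi> t0 x0"
    define \<delta> where "\<delta> = u t0 x0 - \<phi> t0 x0"
    have \<delta>: "0 < \<delta>" using neg by (simp add: \<delta>_def)
    \<comment> \<open>With this size the penalty \<open>\<mu> / (T - s)\<close> equals
      \<open>\<delta> / 2\<close> at \<open>s = t0\<close>, so half of the excess survives.\<close>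
    define \<mu> where "\<mu> = \<delta> * (T - t0) / 2"
    have \<mu>: "0 < \<mu>" using \<delta> t0 by (simp add: \<mu>_def)
    have x0_box: "x0 \<in> box_Rd d R" using far[of t0 x0] t0 x0 neg by auto
    have "compact ({0..T} \<times> box_Rd d R)" by (intro compact_Times compact_box_Rd) auto
    moreover have in_box: "(t0, x0) \<in> {0..T} \<times> box_Rd d R" using t0 x0_box by auto
    ultimately obtain z1 where z1: "z1 \<in> {0..T} \<times> box_Rd d R"
      "\<forall>z\<in>{0..T} \<times> box_Rd d R. u (fst z) (snd z) - \<phi> (fst z) (snd z) \<le> u (fst z1) (snd z1) - \<phi> (fst z1) (snd z1)"
      using continuous_attains_sup[of "{0..T} \<times> box_Rd d R" "\<lambda>z. u (fst z) (snd z) - \<phi> (fst z) (snd z)"]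
        continuous_on_subset[OF diff_cont Sigma_mono[OF order_refl box]] in_box by blast
    define c where "c = u (fst z1) (snd z1) - \<phi> (fst z1) (snd z1)"
    have c: "u s y - \<phi> s y \<le> c" if "s \<in> {0..T}" "y \<in> box_Rd d R" for s y
      using z1(2) that unfolding c_def by force
    have "\<delta> \<le> c" using c[of t0 x0] t0 x0_box by (simp add: \<delta>_def)
    then have c_pos: "0 < c" using \<delta> by linarith
    \<comment> \<open>After \<open>T1\<close> the penalty is at least \<open>c\<close>, the maximum
      of \<open>u - \<phi>\<close> on the box, so \<psi> is not positive there and a compact time
      interval suffices. The \<open>min\<close> keeps \<open>t0 \<le> T1\<close>.\<close>
    define T1 where "T1 = T - min (T - t0) (\<mu> / c)"
    have T1: "t0 \<le> T1" "T1 < T" using t0 \<mu> c_pos by (auto simp: T1_def)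
    define \<psi> where "\<psi> = (\<lambda>s y. u s y - (\<phi> s y + \<mu> / (T - s)))"
    have "continuous_on ({0..T1} \<times> box_Rd d R) (\<lambda>z. (u (fst z) (snd z) - \<phi> (fst z) (snd z)) - \<mu> / (T - fst z))"
      using T1 box by (intro continuous_on_diff continuous_on_subset[OF diff_cont] continuous_intros) auto
    moreover have "compact ({0..T1} \<times> box_Rd d R)" by (intro compact_Times compact_box_Rd) auto
    moreover have in0: "(t0, x0) \<in> {0..T1} \<times> box_Rd d R" using T1 t0 x0_box by auto
    ultimately obtain z2 where z2: "z2 \<in> {0..T1} \<times> box_Rd d R"
      "\<forall>z\<in>{0..T1} \<times> box_Rd d R. \<psi> (fst z) (snd z) \<le> \<psi> (fst z2) (snd z2)"
      unfolding \<psi>_def diff_diff_eq[symmetric]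
      using continuous_attains_sup[of "{0..T1} \<times> box_Rd d R" "\<lambda>z. (u (fst z) (snd z) - \<phi> (fst z) (snd z)) - \<mu> / (T - fst z)"]
      by blast
    obtain t2 x2 where z2_eq: "z2 = (t2, x2)" by (cases z2)
    have "\<psi> t0 x0 = \<delta> / 2" using t0 by (simp add: \<psi>_def \<delta>_def \<mu>_def field_simps)
    then have pos: "0 < \<psi> t2 x2" using bspec[OF z2(2) in0] \<delta> z2_eq by simp
    have x2: "x2 \<in> Rd d" and t2: "0 \<le> t2" "t2 < T" using z2(1) z2_eq box T1 by auto
    have "\<psi> 0 x2 < 0" 
      unfolding \<psi>_def diff_0_right using init[OF x2] divide_pos_pos[OF \<mu> T] by linarith
    then have t2': "t2 \<in> {0<..<T}" using pos t2 by (cases "t2 = 0") auto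
    have "\<psi> s y \<le> \<psi> t2 x2" if s: "s \<in> {0<..<T}" and y: "y \<in> Rd d" for s y
    proof (cases "y \<in> box_Rd d R")
      case False
      then have "u s y \<le> \<phi> s y" using far s y by auto
      moreover have "0 < \<mu> / (T - s)" using \<mu> s by auto
      ultimately have "\<psi> s y \<le> 0" by (simp add: \<psi>_def)
      then show ?thesis using pos by linarith
    next
      case True
      show ?thesis
      proof (cases "s \<le> T1")
        case True
        then show ?thesis using z2 z2_eq s \<open>y \<in> box_Rd d R\<close> by force
      next
        case False
        then have "T - s < \<mu> / c" by (auto simp: T1_def)
        then have "c \<le> \<mu> / (T - s)" using s c_pos by (simp add: field_simps)
        then have "\<psi> s y \<le> 0" using c[of s y] s True by (simp add: \<psi>_def)
        then show ?thesis using pos by linarith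
      qed
    qed
    moreover have "C12 T d (\<lambda>t x. \<phi> t x + \<mu> / (T - t) * 1) (\<lambda>t x. \<phi>t t x + \<mu> / (T - t)\<^sup>2 * 1)
      (\<lambda>i t x. D1 i t x + \<mu> / (T - t) * 0) (\<lambda>i j t x. D2 i j t x + \<mu> / (T - t) * 0)"
      by (intro C12_add[OF C] C12_separated)
        (auto intro!: derivative_eq_intros continuous_intros simp: power2_eq_square)
    ultimately have "\<phi>t t2 x2 + \<mu> / (T - t2)\<^sup>2 * 1 \<le> (\<Sum>i<d. D2 i i t2 x2 + \<mu> / (T - t2) * 0) + F t2 x2"
      using sub t2' x2 unfolding global_subsolution_def \<psi>_def mult_1_right by blast
    moreover have "0 < \<mu> / (T - t2)\<^sup>2" using \<mu> t2 by auto
    ultimately show False using strict[OF t2' x2] H[OF t2' x2] by simp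
  qed
  \<comment> \<open>The viscosity inequality is tested only before \<open>T\<close>; the final time
    follows by continuity.\<close>
  have "continuous_on {0..T} (\<lambda>s. u (fst (s, x)) (snd (s, x)) - \<phi> (fst (s, x)) (snd (s, x)))"
    by (rule continuous_on_compose2[OF diff_cont]) (use x in \<open>auto intro!: continuous_intros\<close>)
  from continuous_on_minus[OF this] have "continuous_on {0..T} (\<lambda>s. \<phi> s x - u s x)"
    by simp
  then have "0 \<le> \<phi> t x - u t x"
    using continuous_ge_on_closure[of "{0..<T}" "\<lambda>s. \<phi> s x - u s x" t 0] before_T x t T
    by auto
  then show ?thesis by simp
qed

section \<open>Trigonometric data\<close>

lemma continuous_on_if_derivative:
  "(\<And>t. t \<in> S \<Longrightarrow> (p has_real_derivative p' t) (at t)) \<Longrightarrow> continuous_on S p"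
  by (intro continuous_at_imp_continuous_on ballI DERIV_isCont) blast

lemma heat_op_cong:
  assumes "heat_op T d v H" "\<And>t x. t \<in> {0<..<T} \<Longrightarrow> x \<in> Rd d \<Longrightarrow> H t x = H' t x"
  shows "heat_op T d v H'"
  using assms by (simp add: heat_op_def)

text \<open>The phase \<open>b\<close> covers the sines. Powers of \<open>t\<close> are included
  because the approximation is made jointly in time and space; for each generator the heat equation
  reduces to a scalar linear ODE in time.\<close>

inductive_set trig_span :: "nat \<Rightarrow> (real \<Rightarrow> (nat \<Rightarrow> real) \<Rightarrow> real) set" for d where
  mode: "(\<lambda>t x. t ^ k * cos ((\<Sum>i<d. \<xi> i * x i) + b)) \<in> trig_span d"
| scale: "G \<in> trig_span d \<Longrightarrow> (\<lambda>t x. c * G t x) \<in> trig_span d"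
| add: "G \<in> trig_span d \<Longrightarrow> G' \<in> trig_span d \<Longrightarrow> (\<lambda>t x. G t x + G' t x) \<in> trig_span d"

lemma trig_span_cong: "G \<in> trig_span d \<Longrightarrow> (\<And>t x. G t x = G' t x) \<Longrightarrow> G' \<in> trig_span d"
  by (metis ext)

text \<open>By the product-to-sum formula, a product of two cosines is a combination of cosines with
  added and subtracted frequencies and phases.\<close>

lemma trig_span_mult_mode:
  assumes "G \<in> trig_span d"
  shows "(\<lambda>t x. t ^ k * cos ((\<Sum>i<d. \<xi> i * x i) + b) * G t x) \<in> trig_span d"
  using assms
proof induction
  case (mode l \<eta> c)
  have "(\<lambda>t x. (1/2) * (t ^ (k + l) * cos ((\<Sum>i<d. (\<xi> i - \<eta> i) * x i) + (b - c)))
      + (1/2) * (t ^ (k + l) * cos ((\<Sum>i<d. (\<xi> i + \<eta> i) * x i) + (b + c)))) \<in> trig_span d"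
    by (intro trig_span.intros)
  then show ?case
  proof (rule trig_span_cong)
    fix t and x :: "nat \<Rightarrow> real"
    have "(\<Sum>i<d. (\<xi> i - \<eta> i) * x i) + (b - c) = ((\<Sum>i<d. \<xi> i * x i) + b) - ((\<Sum>i<d. \<eta> i * x i) + c)"
      and "(\<Sum>i<d. (\<xi> i + \<eta> i) * x i) + (b + c) = ((\<Sum>i<d. \<xi> i * x i) + b) + ((\<Sum>i<d. \<eta> i * x i) + c)"
      by (simp_all add: left_diff_distrib distrib_right sum_subtractf sum.distrib)
    then show "(1/2) * (t ^ (k + l) * cos ((\<Sum>i<d. (\<xi> i - \<eta> i) * x i) + (b - c)))
      + (1/2) * (t ^ (k + l) * cos ((\<Sum>i<d. (\<xi> i + \<eta> i) * x i) + (b + c)))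
      = t ^ k * cos ((\<Sum>i<d. \<xi> i * x i) + b) * (t ^ l * cos ((\<Sum>i<d. \<eta> i * x i) + c))"
      by (simp only: cos_add cos_diff power_add) (simp add: algebra_simps)
  qed
next
  case (scale G c)
  from trig_span.scale[OF scale.IH, of c] show ?case
    by (rule trig_span_cong) simp
next
  case (add G G')
  from trig_span.add[OF add.IH] show ?case
    by (rule trig_span_cong) (simp add: distrib_left)
qed

lemma trig_span_mult:
  assumes "G \<in> trig_span d" "G' \<in> trig_span d"
  shows "(\<lambda>t x. G t x * G' t x) \<in> trig_span d"
  using assms(1)
proof induction
  case (mode k \<xi> b)
  show ?case by (rule trig_span_mult_mode[OF assms(2)])
next
  case (scale G c)
  from trig_span.scale[OF scale.IH, of c] show ?case
    by (rule trig_span_cong) simp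
next
  case (add G G')
  from trig_span.add[OF add.IH] show ?case
    by (rule trig_span_cong) (simp add: distrib_right)
qed

text \<open>Each cosine is an eigenfunction of the Laplacian, with eigenvalue minus the squared
  length of its frequency, so the heat operator acts on the factor \<open>p\<close> alone.\<close>

lemma heat_op_mode:
  assumes p: "\<And>t. t \<in> {0..T} \<Longrightarrow> (p has_real_derivative p' t) (at t)" and p': "continuous_on {0<..<T} p'"
  shows "heat_op T d (\<lambda>t x. p t * cos ((\<Sum>i<d. \<xi> i * x i) + b))
    (\<lambda>t x. (p' t + (\<Sum>i<d. (\<xi> i)\<^sup>2) * p t) * cos ((\<Sum>i<d. \<xi> i * x i) + b))"
proof -
  have lin: "((\<lambda>y. (\<Sum>j<d. \<xi> j * (x(i := y)) j) + b) has_real_derivative \<xi> i) (at (x i))"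
    if i: "i < d" for x i
  proof -
    have "(\<Sum>j<d. \<xi> j * (x(i := y)) j) = \<xi> i * y + (\<Sum>j\<in>{..<d} - {i}. \<xi> j * x j)" for y
    proof -
      have "(\<Sum>j<d. \<xi> j * (x(i := y)) j) = \<xi> i * y + (\<Sum>j\<in>{..<d} - {i}. \<xi> j * (x(i := y)) j)"
        using i by (subst sum.remove[of _ i]) auto
      also have "(\<Sum>j\<in>{..<d} - {i}. \<xi> j * (x(i := y)) j) = (\<Sum>j\<in>{..<d} - {i}. \<xi> j * x j)"
        by (rule sum.cong) auto
      finally show ?thesis .
    qed
    then show ?thesis by (auto intro!: derivative_eq_intros)
  qed
  define e where "e = (\<lambda>x. cos ((\<Sum>i<d. \<xi> i * x i) + b))"
  define e1 where "e1 = (\<lambda>i x. - sin ((\<Sum>i<d. \<xi> i * x i) + b) * \<xi> i)"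
  define e2 where "e2 = (\<lambda>i j x. - cos ((\<Sum>i<d. \<xi> i * x i) + b) * \<xi> j * \<xi> i)"
  have C: "C12 T d (\<lambda>t x. p t * e x) (\<lambda>t x. p' t * e x) (\<lambda>i t x. p t * e1 i x) (\<lambda>i j t x. p t * e2 i j x)"
  proof (rule C12_separated)
    fix x :: "nat \<Rightarrow> real" and i assume i: "i < d"
    show "((\<lambda>y. e (x(i := y))) has_real_derivative e1 i x) (at (x i))"
      unfolding e_def e1_def using DERIV_fun_cos[OF lin[OF i, of x]] by simp
    fix j assume j: "j < d"
    show "((\<lambda>y. e1 i (x(j := y))) has_real_derivative e2 i j x) (at (x j))"
      unfolding e1_def e2_def
      using DERIV_cmult_right[OF DERIV_minus[OF DERIV_fun_sin[OF lin[OF j, of x]]], of "\<xi> i"] by simp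
  qed (use p p' in \<open>auto simp: e_def e1_def e2_def intro!: continuous_intros\<close>)
  have "continuous_on {0..T} p"
    using p by (rule continuous_on_if_derivative)
  then have "continuous_on ({0..T} \<times> Rd d) (\<lambda>z. p (fst z))"
    by (rule continuous_on_compose2) (auto intro!: continuous_intros)
  then have "continuous_on ({0..T} \<times> Rd d) (\<lambda>(t, x). p t * e x)"
    unfolding case_prod_beta' e_def by (intro continuous_intros)
  moreover have "(p' t + (\<Sum>i<d. (\<xi> i)\<^sup>2) * p t) * e x = p' t * e x - (\<Sum>i<d. p t * e2 i i x)" for t x
  proof -
    have "(\<Sum>i<d. p t * e2 i i x) = - ((\<Sum>i<d. (\<xi> i)\<^sup>2) * p t * e x)"
      unfolding e2_def e_def sum_distrib_right sum_negf[symmetric]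
      by (rule sum.cong) (auto simp: power2_eq_square)
    then show ?thesis by (simp add: distrib_right)
  qed
  ultimately have "heat_op T d (\<lambda>t x. p t * e x) (\<lambda>t x. (p' t + (\<Sum>i<d. (\<xi> i)\<^sup>2) * p t) * e x)"
    unfolding heat_op_def using C by blast
  then show ?thesis by (simp add: e_def)
qed

lemma bounded_mode:
  fixes p :: "real \<Rightarrow> real"
  assumes "\<And>t. t \<in> {0..T} \<Longrightarrow> (p has_real_derivative p' t) (at t)"
  shows "\<exists>B. \<forall>t\<in>{0..T}. \<forall>x. \<bar>p t * cos (a x)\<bar> \<le> B"
proof -
  have "continuous_on {0..T} p"
    using assms by (rule continuous_on_if_derivative)
  then have "bounded (p ` {0..T})"
    by (intro compact_imp_bounded compact_continuous_image) auto
  then obtain B where "\<forall>y\<in>p ` {0..T}. norm y \<le> B"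
    unfolding bounded_iff by blast
  then have B: "\<bar>p t\<bar> \<le> B" if "t \<in> {0..T}" for t
    using that by simp
  have "\<bar>p t * cos (a x)\<bar> \<le> B" if "t \<in> {0..T}" for t x
  proof -
    have "\<bar>p t * cos (a x)\<bar> \<le> \<bar>p t\<bar>"
      by (simp add: abs_mult mult_left_le)
    then show ?thesis using B[OF that] by linarith
  qed
  then show ?thesis by blast
qed

lemma linear_ode_exists:
  fixes q :: "real \<Rightarrow> real"
  assumes q: "continuous_on UNIV q"
  obtains p p' where "p 0 = 0" "\<And>t. t \<in> {0..T} \<Longrightarrow> (p has_real_derivative p' t) (at t)"
    "continuous_on {0<..<T} p'" "\<And>t. t \<in> {0..T} \<Longrightarrow> p' t + \<sigma> * p t = q t"
proof -
  \<comment> \<open>Integrating factor. The interval is enlarged at both ends so that the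
    antiderivative has two-sided derivatives at 0 and \<open>T\<close>.\<close>
  have "continuous_on {-1..T + 1} (\<lambda>t. exp (\<sigma> * t) * q t)"
    by (intro continuous_intros continuous_on_subset[OF q]) auto
  from antiderivative_continuous[OF this] obtain Q where
    Q: "\<And>t. t \<in> {-1..T + 1} \<Longrightarrow> (Q has_vector_derivative exp (\<sigma> * t) * q t) (at t within {-1..T + 1})"
    by blast
  have Q': "(Q has_real_derivative exp (\<sigma> * t) * q t) (at t)" if "t \<in> {0..T}" for t
    using Q[of t] that at_within_Icc_at[of "-1" t "T + 1"]
    by (simp add: has_real_derivative_iff_has_vector_derivative)
  define p where "p = (\<lambda>t. exp (- (\<sigma> * t)) * (Q t - Q 0))"
  define p' where "p' = (\<lambda>t. q t - \<sigma> * p t)"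
  have p: "(p has_real_derivative p' t) (at t)" if "t \<in> {0..T}" for t
    unfolding p_def p'_def
    by (rule derivative_eq_intros Q'[OF that] refl)+ (simp add: exp_minus field_simps)
  have "continuous_on {0<..<T} p"
    by (rule continuous_on_if_derivative[of _ p p']) (rule p, simp)
  then have "continuous_on {0<..<T} p'"
    unfolding p'_def by (intro continuous_intros continuous_on_subset[OF q subset_UNIV])
  with p show thesis by (intro that[of p p']) (auto simp: p_def p'_def)
qed

text \<open>The source contributes with zero initial value, the initial value with zero source;
  linearity adds the two. The bound \<open>B\<close> is what later lets a barrier dominate the
  solution outside a large box.\<close>

lemma heat_source_solution:
  assumes "G \<in> trig_span d"
  shows "\<exists>v B. heat_op T d v G \<and> (\<forall>x. v 0 x = 0) \<and> (\<forall>t\<in>{0..T}. \<forall>x. \<bar>v t x\<bar> \<le> B)"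
  using assms
proof induction
  case (mode k \<xi> b)
  obtain p p' where p: "p 0 = 0" "\<And>t. t \<in> {0..T} \<Longrightarrow> (p has_real_derivative p' t) (at t)"
    "continuous_on {0<..<T} p'" "\<And>t. t \<in> {0..T} \<Longrightarrow> p' t + (\<Sum>i<d. (\<xi> i)\<^sup>2) * p t = t ^ k"
    using linear_ode_exists[OF continuous_on_power[OF continuous_on_id]] by blast
  have "heat_op T d (\<lambda>t x. p t * cos ((\<Sum>i<d. \<xi> i * x i) + b)) (\<lambda>t x. t ^ k * cos ((\<Sum>i<d. \<xi> i * x i) + b))"
    using p(4) by (intro heat_op_cong[OF heat_op_mode[OF p(2,3)]]) auto
  then show ?case
    using p(1) bounded_mode[OF p(2), where a = "\<lambda>x. (\<Sum>i<d. \<xi> i * x i) + b"]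
    by (intro exI[of _ "\<lambda>t x. p t * cos ((\<Sum>i<d. \<xi> i * x i) + b)"]) auto
next
  case (scale G c)
  then obtain v B where v: "heat_op T d v G" "\<forall>x. v 0 x = 0" "\<forall>t\<in>{0..T}. \<forall>x. \<bar>v t x\<bar> \<le> B" by blast
  then have "\<forall>t\<in>{0..T}. \<forall>x. \<bar>c * v t x\<bar> \<le> \<bar>c\<bar> * B" by (simp add: abs_mult mult_left_mono)
  moreover have "\<forall>x. c * v 0 x = 0" using v by simp
  ultimately show ?case using heat_op_cmult[OF v(1), of c] by blast
next
  case (add G G')
  then obtain v B w B' where v: "heat_op T d v G" "\<forall>x. v 0 x = 0" "\<forall>t\<in>{0..T}. \<forall>x. \<bar>v t x\<bar> \<le> B"
    and w: "heat_op T d w G'" "\<forall>x. w 0 x = 0" "\<forall>t\<in>{0..T}. \<forall>x. \<bar>w t x\<bar> \<le> B'" by blast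
  then have "\<forall>t\<in>{0..T}. \<forall>x. \<bar>v t x + w t x\<bar> \<le> B + B'" by (meson abs_triangle_ineq add_mono order_trans)
  moreover have "\<forall>x. v 0 x + w 0 x = 0" using v w by simp
  ultimately show ?case using heat_op_add[OF v(1) w(1)] by blast
qed

lemma heat_initial_solution:
  assumes "G \<in> trig_span d"
  shows "\<exists>v B. heat_op T d v (\<lambda>t x. 0) \<and> (\<forall>x. v 0 x = G 0 x) \<and> (\<forall>t\<in>{0..T}. \<forall>x. \<bar>v t x\<bar> \<le> B)"
  using assms
proof induction
  case (mode k \<xi> b)
  define \<sigma> where "\<sigma> = (\<Sum>i<d. (\<xi> i)\<^sup>2)"
  \<comment> \<open>\<open>0 ^ k\<close> is the time factor of the mode at time 0: 1 for
    \<open>k = 0\<close> and 0 otherwise.\<close>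
  define p where "p = (\<lambda>t. 0 ^ k * exp (- \<sigma> * t))"
  define p' where "p' = (\<lambda>t. - \<sigma> * p t)"
  have p: "(p has_real_derivative p' t) (at t)" for t
    unfolding p_def p'_def by (rule derivative_eq_intros refl | simp)+
  have p': "continuous_on {0<..<T} p'"
    unfolding p_def p'_def by (intro continuous_intros)
  have "heat_op T d (\<lambda>t x. p t * cos ((\<Sum>i<d. \<xi> i * x i) + b)) (\<lambda>t x. 0)"
    using heat_op_mode[OF p p', of d \<xi> b] by (simp add: p'_def \<sigma>_def)
  then show ?case
    using bounded_mode[OF p, where T = T and a = "\<lambda>x. (\<Sum>i<d. \<xi> i * x i) + b"]
    by (intro exI[of _ "\<lambda>t x. p t * cos ((\<Sum>i<d. \<xi> i * x i) + b)"]) (auto simp: p_def)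
next
  case (scale G c)
  then obtain v B where v: "heat_op T d v (\<lambda>t x. 0)" "\<forall>x. v 0 x = G 0 x" "\<forall>t\<in>{0..T}. \<forall>x. \<bar>v t x\<bar> \<le> B" by blast
  then have "\<forall>t\<in>{0..T}. \<forall>x. \<bar>c * v t x\<bar> \<le> \<bar>c\<bar> * B" by (simp add: abs_mult mult_left_mono)
  moreover have "\<forall>x. c * v 0 x = c * G 0 x" using v by simp
  moreover have "heat_op T d (\<lambda>t x. c * v t x) (\<lambda>t x. 0)" using heat_op_cmult[OF v(1), of c] by simp
  ultimately show ?case by blast
next
  case (add G G')
  then obtain v B w B' where v: "heat_op T d v (\<lambda>t x. 0)" "\<forall>x. v 0 x = G 0 x" "\<forall>t\<in>{0..T}. \<forall>x. \<bar>v t x\<bar> \<le> B"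
    and w: "heat_op T d w (\<lambda>t x. 0)" "\<forall>x. w 0 x = G' 0 x" "\<forall>t\<in>{0..T}. \<forall>x. \<bar>w t x\<bar> \<le> B'" by blast
  then have "\<forall>t\<in>{0..T}. \<forall>x. \<bar>v t x + w t x\<bar> \<le> B + B'" by (meson abs_triangle_ineq add_mono order_trans)
  moreover have "\<forall>x. v 0 x + w 0 x = G 0 x + G' 0 x" using v w by simp
  moreover have "heat_op T d (\<lambda>t x. v t x + w t x) (\<lambda>t x. 0)" using heat_op_add[OF v(1) w(1)] by simp
  ultimately show ?case by blast
qed

section \<open>Approximation by trigonometric data\<close>

text \<open>Cosines are left out on purpose: since \<open>cos (arcsin (sin z))\<close> is
  \<open>\<bar>cos z\<bar>\<close>, they would not be invariant under folding a coordinate into the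
  box. The sines of one frequency already separate the spatial points of a box on which they are
  injective.\<close>

inductive_set trig_algebra :: "real \<Rightarrow> nat \<Rightarrow> (real \<times> (nat \<Rightarrow> real) \<Rightarrow> real) set" for a d where
  const: "(\<lambda>z. c) \<in> trig_algebra a d"
| time: "fst \<in> trig_algebra a d"
| coord: "i < d \<Longrightarrow> (\<lambda>z. sin (a * snd z i)) \<in> trig_algebra a d"
| add: "G \<in> trig_algebra a d \<Longrightarrow> G' \<in> trig_algebra a d \<Longrightarrow> (\<lambda>z. G z + G' z) \<in> trig_algebra a d"
| mult: "G \<in> trig_algebra a d \<Longrightarrow> G' \<in> trig_algebra a d \<Longrightarrow> (\<lambda>z. G z * G' z) \<in> trig_algebra a d"

lemma trig_algebra_continuous: "G \<in> trig_algebra a d \<Longrightarrow> continuous_on S G"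
  by (induction rule: trig_algebra.induct) (auto intro!: continuous_intros)

lemma trig_algebra_fold:
  "G \<in> trig_algebra a d \<Longrightarrow> (\<And>i. i < d \<Longrightarrow> sin (a * x i) = sin (a * y i)) \<Longrightarrow> G (t, x) = G (t, y)"
  by (induction rule: trig_algebra.induct) auto

lemma trig_algebra_span: "G \<in> trig_algebra a d \<Longrightarrow> (\<lambda>t x. G (t, x)) \<in> trig_span d"
proof (induction rule: trig_algebra.induct)
  case (const c)
  from trig_span.scale[OF trig_span.mode[of 0 "\<lambda>_. 0" d 0], of c] show ?case by simp
next
  case time
  from trig_span.mode[of 1 "\<lambda>_. 0" d 0] show ?case by simp
next
  case (coord i)
  have "(\<Sum>j<d. (if j = i then a else 0) * x j) = a * x i" for x
    using coord by (simp add: if_distrib[of "\<lambda>c. c * _"] cong: if_cong)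
  with trig_span.mode[of 0 "\<lambda>j. if j = i then a else 0" d "- pi / 2"] show ?case
    by (simp add: cos_diff flip: diff_conv_add_uminus)
qed (auto intro: trig_span.add trig_span_mult)

lemma abs_arcsin_sin_le: "\<bar>arcsin (sin z)\<bar> \<le> \<bar>z\<bar>"
proof (cases "\<bar>z\<bar> \<le> pi / 2")
  case True
  then show ?thesis by (simp add: arcsin_sin abs_le_iff)
next
  case False
  then show ?thesis using arcsin_lbound[of "sin z"] arcsin_ubound[of "sin z"] by (auto simp: abs_le_iff)
qed

text \<open>
  The approximant depends on \<open>x i\<close> only through \<open>sin (a * x i)\<close>, so its values anywhere are
  values at points of the box that are no farther from the origin: this extends the uniform
  approximation on the box to a weighted one on the whole space.
\<close>

lemma trig_approximation:
  assumes F: "continuous_on ({0..T} \<times> Rd d) (\<lambda>(t, x). F t x)"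
    and growth: "\<And>t x. t \<in> {0..T} \<Longrightarrow> x \<in> Rd d \<Longrightarrow> \<bar>F t x\<bar> \<le> K * weight d x ^ n"
    and \<eta>: "0 < \<eta>"
  obtains G where "G \<in> trig_span d"
    "\<And>t x. t \<in> {0..T} \<Longrightarrow> x \<in> Rd d \<Longrightarrow> \<bar>F t x - G t x\<bar> \<le> \<eta> * weight d x ^ (n + 1)"
proof -
  \<comment> \<open>Outside this box one further power of the weight, times \<eta>, absorbs
    \<open>2 * K + 1\<close>: twice the growth of \<open>F\<close> plus the accuracy 1 of the
    approximant at the folded point.\<close>
  obtain R where R: "0 < R" "\<And>x. x \<in> Rd d \<Longrightarrow> x \<notin> box_Rd d R \<Longrightarrow> (2 * K + 1) / \<eta> \<le> weight d x"
    using weight_large by metis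
  \<comment> \<open>A quarter period covers \<open>[0, R]\<close>, so \<open>sin (a * s)\<close> is
    injective for \<open>s\<close> in \<open>[-R, R]\<close>.\<close>
  define a where "a = pi / (2 * R)"
  have a: "0 < a" "a * R = pi / 2" using R(1) by (auto simp: a_def)
  define S where "S = {0..T} \<times> box_Rd d R"
  have box: "box_Rd d R \<subseteq> Rd d" by (auto simp: box_Rd_def)
  interpret function_ring_on "trig_algebra a d" S
  proof
    show "compact S" unfolding S_def by (intro compact_Times compact_box_Rd) auto
    fix z w assume z: "z \<in> S" and w: "w \<in> S" and "z \<noteq> w"
    show "\<exists>f\<in>trig_algebra a d. f z \<noteq> f w"
    proof (cases "fst z = fst w")
      case True
      then have "snd z \<noteq> snd w" using \<open>z \<noteq> w\<close> by (simp add: prod_eq_iff)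
      then obtain i where i: "snd z i \<noteq> snd w i" by blast
      have "i < d"
      proof (rule ccontr)
        assume "\<not> i < d"
        then show False using i z w by (auto simp: S_def box_Rd_def Rd_def PiE_def extensional_def)
      qed
      have "a * \<bar>y i\<bar> \<le> pi / 2" if "y \<in> box_Rd d R" for y
        unfolding a(2)[symmetric] using that \<open>i < d\<close> a(1) by (simp add: box_Rd_def)
      then have *: "\<bar>a * y i\<bar> \<le> pi / 2" if "y \<in> box_Rd d R" for y
        using that a by (simp add: abs_mult)
      have "\<bar>a * snd z i\<bar> \<le> pi / 2" "\<bar>a * snd w i\<bar> \<le> pi / 2"
        using * z w by (auto simp: S_def)
      then have "sin (a * snd z i) \<noteq> sin (a * snd w i)"
        using sin_inj_pi[of "a * snd z i" "a * snd w i"] i a(1) by (auto simp only: abs_le_iff) simp_all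
      then show ?thesis using trig_algebra.coord[OF \<open>i < d\<close>, of a] by (intro bexI)
    qed (use trig_algebra.time in blast)
  qed (auto intro: trig_algebra.intros trig_algebra_continuous)
  have "continuous_on S (\<lambda>(t, x). F t x)"
    using F box by (rule_tac continuous_on_subset) (auto simp: S_def)
  \<comment> \<open>Accuracy \<eta> serves the points of the box, accuracy 1 those folded into
    it.\<close>
  from Stone_Weierstrass_basic[OF this, of "min \<eta> 1"] \<eta> obtain G where
    G: "G \<in> trig_algebra a d" "\<forall>z\<in>S. \<bar>(case z of (t, x) \<Rightarrow> F t x) - G z\<bar> < min \<eta> 1"
    by (metis min_less_iff_conj zero_less_one)
  have approx: "\<bar>F t x - G (t, x)\<bar> < min \<eta> 1" if "t \<in> {0..T}" "x \<in> box_Rd d R" for t x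
    using bspec[OF G(2), of "(t, x)"] that by (simp add: S_def)
  have "\<bar>F t x - G (t, x)\<bar> \<le> \<eta> * weight d x ^ (n + 1)" if t: "t \<in> {0..T}" and x: "x \<in> Rd d" for t x
  proof (cases "x \<in> box_Rd d R")
    case True
    then have "\<bar>F t x - G (t, x)\<bar> \<le> \<eta> * 1" using approx[OF t, of x] by simp
    also have "\<dots> \<le> \<eta> * weight d x ^ (n + 1)" 
      using \<eta> one_le_power[OF weight_ge_1[of d x], of "n + 1"] by (intro mult_left_mono) auto
    finally show ?thesis .
  next
    case False
    define y where "y = restrict (\<lambda>i. arcsin (sin (a * x i)) / a) {..<d}"
    have y_le: "\<bar>y i\<bar> \<le> \<bar>x i\<bar>" if "i < d" for i
      using abs_arcsin_sin_le[of "a * x i"] a that by (simp add: y_def abs_mult field_simps)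
    have y_R: "\<bar>y i\<bar> \<le> R" if "i < d" for i
    proof -
      have "\<bar>arcsin (sin (a * x i))\<bar> \<le> a * R"
        using arcsin_lbound[of "sin (a * x i)"] arcsin_ubound[of "sin (a * x i)"] a(2) by (auto simp: abs_le_iff)
      then show ?thesis using that a by (simp add: y_def field_simps)
    qed
    have y: "y \<in> box_Rd d R" using y_R by (auto simp: box_Rd_def Rd_def y_def)
    have "weight d y \<le> weight d x"
      unfolding weight_def by (intro add_left_mono sum_mono) (auto intro: y_le abs_le_square_iff[THEN iffD1])
    have K: "0 \<le> K"
    proof (rule ccontr)
      assume "\<not> 0 \<le> K"
      then have "K * weight d x ^ n < 0" using weight_pos[of d x] by (simp add: mult_neg_pos)
      then show False using growth[OF t x] by simp
    qed
    have ge1: "1 \<le> weight d x ^ n" using weight_ge_1 by (rule one_le_power)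
    have "G (t, x) = G (t, y)"
      using a by (intro trig_algebra_fold[OF G(1)]) (simp add: y_def)
    also have "\<bar>\<dots>\<bar> \<le> \<bar>F t y\<bar> + 1" using approx[OF t y] by linarith
    also have "\<bar>F t y\<bar> \<le> K * weight d y ^ n" using growth[OF t] y box by blast
    also have "\<dots> \<le> K * weight d x ^ n"
      using K \<open>weight d y \<le> weight d x\<close> weight_pos[of d y] by (intro mult_left_mono power_mono) auto
    finally have "\<bar>F t x - G (t, x)\<bar> \<le> (2 * K) * weight d x ^ n + 1"
      using growth[OF t x] by linarith
    also have "\<dots> \<le> (2 * K + 1) * weight d x ^ n" using ge1 by (simp add: distrib_right)
    also have "\<dots> \<le> (\<eta> * weight d x) * weight d x ^ n"
      using R(2)[OF x False] \<eta> ge1 by (intro mult_right_mono) (auto simp: field_simps)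
    finally show ?thesis by (simp add: mult.assoc)
  qed
  with trig_algebra_span[OF G(1)] show thesis by (rule that)
qed

section \<open>Stability of viscosity solutions\<close>

lemma le_power_Suc_weight:
  assumes "0 < \<eta>" "c / \<eta> \<le> weight d x"
  shows "c * weight d x ^ n \<le> \<eta> * weight d x ^ (n + 1)"
proof -
  have "c \<le> \<eta> * weight d x" using assms by (simp add: field_simps)
  then have "c * weight d x ^ n \<le> (\<eta> * weight d x) * weight d x ^ n"
    using weight_pos[of d x] by (intro mult_right_mono) auto
  then show ?thesis by (simp add: mult.assoc)
qed

text \<open>The barrier term supplies what \<open>comparison\<close> demands. With rate 1 it raises
  the source by at least \<open>\<eta> * weight d x ^ (n + 1)\<close>, and its exponent, one above
  the growth of \<open>u\<close>, makes it dominate \<open>u\<close> and the lower bound of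
  \<open>v\<close> outside a box.\<close>

lemma comparison_barrier:
  assumes T: "0 < T" and sub: "global_subsolution T d u F"
    and u: "continuous_on ({0..T} \<times> Rd d) (\<lambda>(t, x). u t x)"
    and growth: "\<And>t x. t \<in> {0..T} \<Longrightarrow> x \<in> Rd d \<Longrightarrow> u t x \<le> K * weight d x ^ n"
    and v: "heat_op T d v H" "\<And>t x. t \<in> {0..T} \<Longrightarrow> x \<in> Rd d \<Longrightarrow> - B \<le> v t x"
    and \<eta>: "0 < \<eta>"
    and FH: "\<And>t x. t \<in> {0<..<T} \<Longrightarrow> x \<in> Rd d \<Longrightarrow> F t x < H t x + \<eta> * weight d x ^ (n + 1)"
    and init: "\<And>x. x \<in> Rd d \<Longrightarrow> u 0 x \<le> v 0 x + \<eta> * weight d x ^ (n + 1)"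
    and t: "t \<in> {0..T}" and x: "x \<in> Rd d"
  shows "u t x \<le> v t x + \<eta> * barrier d (n + 1) 1 t x"
proof -
  obtain HW where HW: "heat_op T d (barrier d (n + 1) 1) HW"
    "\<And>t x. 1 * barrier d (n + 1) 1 t x \<le> HW t x"
    using heat_op_barrier by blast
  obtain R where R: "\<And>x. x \<in> Rd d \<Longrightarrow> x \<notin> box_Rd d R \<Longrightarrow> (K + \<bar>B\<bar>) / \<eta> \<le> weight d x"
    using weight_large by metis
  have ge: "\<eta> * weight d x ^ (n + 1) \<le> \<eta> * barrier d (n + 1) 1 t x" if "0 \<le> t" for t x
    using \<eta> barrier_ge[of 1 t d x "n + 1"] that by (intro mult_left_mono) auto
  show ?thesis
  proof (rule comparison[OF T sub u heat_op_add[OF v(1) heat_op_cmult[OF HW(1)]] _ _ _ t x])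
    fix t x assume t: "t \<in> {0<..<T}" and x: "x \<in> Rd d"
    have "\<eta> * weight d x ^ (n + 1) \<le> \<eta> * HW t x"
      using ge[of t x] t \<eta> HW(2)[of t x] mult_left_mono[OF HW(2)[of t x], of \<eta>] by simp
    then show "F t x < H t x + \<eta> * HW t x" using FH[OF t x] by linarith
  next
    fix x assume x: "x \<in> Rd d"
    show "u 0 x \<le> v 0 x + \<eta> * barrier d (n + 1) 1 0 x" using init[OF x] ge[of 0 x] by linarith
  next
    fix t x assume t: "t \<in> {0..T}" and x: "x \<in> Rd d" and out: "x \<notin> box_Rd d R"
    have "1 \<le> weight d x ^ n" using weight_ge_1 by (rule one_le_power)
    then have "\<bar>B\<bar> * 1 \<le> \<bar>B\<bar> * weight d x ^ n" by (intro mult_left_mono) auto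
    moreover have "(K + \<bar>B\<bar>) * weight d x ^ n \<le> \<eta> * weight d x ^ (n + 1)"
      using le_power_Suc_weight[OF \<eta> R[OF x out]] .
    ultimately show "u t x \<le> v t x + \<eta> * barrier d (n + 1) 1 t x"
      using growth[OF t x] v(2)[OF t x] ge[of t x] t by (simp add: distrib_right)
  qed
qed

text \<open>Here \<open>F\<close> is a given source, even where it is later \<open>f\<close> applied
  to \<open>u\<close>. The notion is stable under negation, so each one-sided estimate yields a
  two-sided one.\<close>

definition two_sided_solution ::
  "real \<Rightarrow> nat \<Rightarrow> (real \<Rightarrow> (nat \<Rightarrow> real) \<Rightarrow> real) \<Rightarrow> (real \<Rightarrow> (nat \<Rightarrow> real) \<Rightarrow> real) \<Rightarrow> bool" where
  "two_sided_solution T d u F \<longleftrightarrow>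
     continuous_on ({0..T} \<times> Rd d) (\<lambda>(t, x). u t x) \<and>
     global_subsolution T d u F \<and> global_subsolution T d (\<lambda>t x. - u t x) (\<lambda>t x. - F t x)"

lemma two_sided_solution_neg:
  "two_sided_solution T d u F \<Longrightarrow> two_sided_solution T d (\<lambda>t x. - u t x) (\<lambda>t x. - F t x)"
  unfolding two_sided_solution_def case_prod_beta' by (auto intro: continuous_on_minus)

text \<open>\<open>u\<close> is not smoothed: its data are approximated, the linear problem with
  these data is solved exactly, and comparison transfers the closeness of the data to the
  solutions.\<close>

lemma classical_approximation:
  assumes T: "0 < T" and u: "two_sided_solution T d u F"
    and F: "continuous_on ({0..T} \<times> Rd d) (\<lambda>(t, x). F t x)"
    and u_growth: "\<And>t x. t \<in> {0..T} \<Longrightarrow> x \<in> Rd d \<Longrightarrow> \<bar>u t x\<bar> \<le> K * weight d x ^ n"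
    and F_growth: "\<And>t x. t \<in> {0..T} \<Longrightarrow> x \<in> Rd d \<Longrightarrow> \<bar>F t x\<bar> \<le> K * weight d x ^ n"
    and \<eta>: "0 < \<eta>"
  obtains v H B where "heat_op T d v H"
    "\<And>t x. t \<in> {0..T} \<Longrightarrow> x \<in> Rd d \<Longrightarrow> \<bar>v t x\<bar> \<le> B"
    "\<And>t x. t \<in> {0<..<T} \<Longrightarrow> x \<in> Rd d \<Longrightarrow> \<bar>F t x - H t x\<bar> \<le> \<eta> * weight d x ^ (n + 1)"
    "\<And>t x. t \<in> {0..T} \<Longrightarrow> x \<in> Rd d \<Longrightarrow> \<bar>u t x - v t x\<bar> \<le> \<eta> * barrier d (n + 1) 1 t x"
proof -
  have u_cont: "continuous_on ({0..T} \<times> Rd d) (\<lambda>z. u (fst z) (snd z))"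
    using u unfolding two_sided_solution_def case_prod_beta' by blast
  \<comment> \<open>The initial value is read as a function constant in time, so that
    \<open>trig_approximation\<close> serves for it as well as for the source.\<close>
  have "continuous_on ({0..T} \<times> Rd d) (\<lambda>z. u (fst (0::real, snd z)) (snd (0::real, snd z)))"
    by (rule continuous_on_compose2[OF u_cont, of _ "\<lambda>z. (0, snd z)"]) (use T in \<open>auto intro!: continuous_intros\<close>)
  then have u0: "continuous_on ({0..T} \<times> Rd d) (\<lambda>(t, x). u 0 x)"
    by (simp add: case_prod_beta')
  \<comment> \<open>Half of \<eta>, because \<open>comparison_barrier\<close> asks for a strict
    inequality between the sources.\<close>
  have \<eta>2: "0 < \<eta> / 2" using \<eta> by simp
  obtain G where G: "G \<in> trig_span d"
    "\<And>t x. t \<in> {0..T} \<Longrightarrow> x \<in> Rd d \<Longrightarrow> \<bar>F t x - G t x\<bar> \<le> \<eta> / 2 * weight d x ^ (n + 1)"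
    using trig_approximation[OF F F_growth \<eta>2] by blast
  obtain g where g: "g \<in> trig_span d"
    "\<And>t x. t \<in> {0..T} \<Longrightarrow> x \<in> Rd d \<Longrightarrow> \<bar>u 0 x - g t x\<bar> \<le> \<eta> / 2 * weight d x ^ (n + 1)"
    using trig_approximation[OF u0 _ \<eta>2, of K n] u_growth[of 0] T by auto
  obtain v1 B1 where v1: "heat_op T d v1 G" "\<forall>x. v1 0 x = 0" "\<forall>t\<in>{0..T}. \<forall>x. \<bar>v1 t x\<bar> \<le> B1"
    using heat_source_solution[OF G(1)] by blast
  obtain v2 B2 where v2: "heat_op T d v2 (\<lambda>t x. 0)" "\<forall>x. v2 0 x = g 0 x" "\<forall>t\<in>{0..T}. \<forall>x. \<bar>v2 t x\<bar> \<le> B2"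
    using heat_initial_solution[OF g(1)] by blast
  define v where "v = (\<lambda>t x. v1 t x + v2 t x)"
  have v: "heat_op T d v G" using heat_op_add[OF v1(1) v2(1)] by (simp add: v_def)
  have v_neg: "heat_op T d (\<lambda>t x. - v t x) (\<lambda>t x. - G t x)" using heat_op_cmult[OF v, of "-1"] by simp
  have vB: "\<bar>v t x\<bar> \<le> B1 + B2" if "t \<in> {0..T}" for t x
    unfolding v_def using v1(3) v2(3) that by (meson abs_triangle_ineq add_mono order_trans)
  have small: "\<eta> / 2 * weight d x ^ (n + 1) < \<eta> * weight d x ^ (n + 1)" for x
    using \<eta> weight_pos[of d x] by simp
  have init: "\<bar>u 0 x - v 0 x\<bar> \<le> \<eta> * weight d x ^ (n + 1)" if "x \<in> Rd d" for x
    using g(2)[of 0 x] small[of x] that T v1(2) v2(2) by (simp add: v_def)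
  have GF: "\<bar>F t x - G t x\<bar> < \<eta> * weight d x ^ (n + 1)" if "t \<in> {0<..<T}" "x \<in> Rd d" for t x
    using G(2)[of t x] small[of x] that by simp
  have upper: "u t x \<le> v t x + \<eta> * barrier d (n + 1) 1 t x" if "t \<in> {0..T}" "x \<in> Rd d" for t x
  proof (rule comparison_barrier[OF T _ _ _ v _ \<eta> _ _ that])
    show "global_subsolution T d u F" "continuous_on ({0..T} \<times> Rd d) (\<lambda>(t, x). u t x)"
      using u by (auto simp: two_sided_solution_def)
    show "u t x \<le> K * weight d x ^ n" if "t \<in> {0..T}" "x \<in> Rd d" for t x
      using u_growth[OF that] by linarith
    show "- (B1 + B2) \<le> v t x" if "t \<in> {0..T}" for t x
      using vB[OF that, of x] by linarith
    show "F t x < G t x + \<eta> * weight d x ^ (n + 1)" if "t \<in> {0<..<T}" "x \<in> Rd d" for t x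
      using GF[OF that] by linarith
    show "u 0 x \<le> v 0 x + \<eta> * weight d x ^ (n + 1)" if "x \<in> Rd d" for x
      using init[OF that] by linarith
  qed
  have lower: "- u t x \<le> - v t x + \<eta> * barrier d (n + 1) 1 t x" if "t \<in> {0..T}" "x \<in> Rd d" for t x
  proof (rule comparison_barrier[OF T _ _ _ v_neg _ \<eta> _ _ that])
    show "global_subsolution T d (\<lambda>t x. - u t x) (\<lambda>t x. - F t x)"
      "continuous_on ({0..T} \<times> Rd d) (\<lambda>(t, x). - u t x)"
      using two_sided_solution_neg[OF u] by (auto simp: two_sided_solution_def)
    show "- u t x \<le> K * weight d x ^ n" if "t \<in> {0..T}" "x \<in> Rd d" for t x
      using u_growth[OF that] by linarith
    show "- (B1 + B2) \<le> - v t x" if "t \<in> {0..T}" for t x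
      using vB[OF that, of x] by linarith
    show "- F t x < - G t x + \<eta> * weight d x ^ (n + 1)" if "t \<in> {0<..<T}" "x \<in> Rd d" for t x
      using GF[OF that] by linarith
    show "- u 0 x \<le> - v 0 x + \<eta> * weight d x ^ (n + 1)" if "x \<in> Rd d" for x
      using init[OF that] by linarith
  qed
  show thesis
  proof (rule that[OF v])
    show "\<bar>v t x\<bar> \<le> B1 + B2" if "t \<in> {0..T}" for t x using vB[OF that] .
    show "\<bar>F t x - G t x\<bar> \<le> \<eta> * weight d x ^ (n + 1)" if "t \<in> {0<..<T}" "x \<in> Rd d" for t x
      using GF[OF that] by linarith
    show "\<bar>u t x - v t x\<bar> \<le> \<eta> * barrier d (n + 1) 1 t x" if "t \<in> {0..T}" "x \<in> Rd d" for t x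
      using upper[OF that] lower[OF that] by linarith
  qed
qed

text \<open>Neither \<open>u\<close> nor \<open>u1\<close> need be differentiable. Replacing
  \<open>u\<close> by a classical approximation \<open>v\<close> makes \<open>v + Z\<close>, up to a
  small barrier, a classical majorant with which \<open>u1\<close> can be compared.\<close>

lemma one_sided_stability:
  assumes T: "0 < T" and u: "two_sided_solution T d u F"
    and F: "continuous_on ({0..T} \<times> Rd d) (\<lambda>(t, x). F t x)"
    and u_growth: "\<And>t x. t \<in> {0..T} \<Longrightarrow> x \<in> Rd d \<Longrightarrow> \<bar>u t x\<bar> \<le> K * weight d x ^ n"
    and F_growth: "\<And>t x. t \<in> {0..T} \<Longrightarrow> x \<in> Rd d \<Longrightarrow> \<bar>F t x\<bar> \<le> K * weight d x ^ n"
    and u1: "global_subsolution T d u1 F1" "continuous_on ({0..T} \<times> Rd d) (\<lambda>(t, x). u1 t x)"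
    and u1_growth: "\<And>t x. t \<in> {0..T} \<Longrightarrow> x \<in> Rd d \<Longrightarrow> u1 t x \<le> K * weight d x ^ n"
    and Z: "heat_op T d Z HZ" "\<And>t x. t \<in> {0..T} \<Longrightarrow> x \<in> Rd d \<Longrightarrow> 0 \<le> Z t x"
    and F1: "\<And>t x. t \<in> {0<..<T} \<Longrightarrow> x \<in> Rd d \<Longrightarrow> F1 t x \<le> F t x + HZ t x"
    and init: "\<And>x. x \<in> Rd d \<Longrightarrow> u1 0 x \<le> u 0 x + Z 0 x"
    and t: "t \<in> {0..T}" and x: "x \<in> Rd d"
  shows "u1 t x \<le> u t x + Z t x"
proof (rule field_le_epsilon)
  fix e :: real assume e: "0 < e"
  define W where "W = barrier d (n + 1) 1"
  have W: "weight d x ^ (n + 1) \<le> W t x" if "0 \<le> t" for t x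
    using barrier_ge[of 1 t d x "n + 1"] that by (simp add: W_def)
  have W_pos: "0 < W t x" for t x by (simp add: W_def barrier_pos)
  \<comment> \<open>The total error is \<open>3 * (\<eta> * W t x)\<close>, which is below
    \<open>e\<close>: two parts from comparing \<open>u1\<close> with \<open>v + Z\<close>, one from
    replacing \<open>v\<close> by \<open>u\<close>.\<close>
  define \<eta> where "\<eta> = e / (4 * W t x)"
  have \<eta>: "0 < \<eta>" using e W_pos[of t x] by (simp add: \<eta>_def)
  obtain v H B where v: "heat_op T d v H"
    "\<And>t x. t \<in> {0..T} \<Longrightarrow> x \<in> Rd d \<Longrightarrow> \<bar>v t x\<bar> \<le> B"
    "\<And>t x. t \<in> {0<..<T} \<Longrightarrow> x \<in> Rd d \<Longrightarrow> \<bar>F t x - H t x\<bar> \<le> \<eta> * weight d x ^ (n + 1)"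
    "\<And>t x. t \<in> {0..T} \<Longrightarrow> x \<in> Rd d \<Longrightarrow> \<bar>u t x - v t x\<bar> \<le> \<eta> * W t x"
    using classical_approximation[OF T u F u_growth F_growth \<eta>] unfolding W_def by blast
  have W0: "W 0 x = weight d x ^ (n + 1)" for x by (simp add: W_def barrier_def)
  have "u1 t x \<le> (v t x + Z t x) + (2 * \<eta>) * barrier d (n + 1) 1 t x"
  proof (rule comparison_barrier[OF T u1 u1_growth heat_op_add[OF v(1) Z(1)] _ _ _ _ t x])
    show "- B \<le> v t x + Z t x" if "t \<in> {0..T}" "x \<in> Rd d" for t x
      using v(2)[OF that] Z(2)[OF that] by linarith
    show "F1 t x < H t x + HZ t x + 2 * \<eta> * weight d x ^ (n + 1)"
      if "t \<in> {0<..<T}" "x \<in> Rd d" for t x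
    proof -
      have "0 < \<eta> * weight d x ^ (n + 1)" using \<eta> weight_pos[of d x] by simp
      then show ?thesis using v(3)[OF that] F1[OF that] unfolding mult.assoc[of 2] mult.assoc[of 3] by linarith
    qed
    show "u1 0 x \<le> v 0 x + Z 0 x + 2 * \<eta> * weight d x ^ (n + 1)" if "x \<in> Rd d" for x
    proof -
      have "0 < \<eta> * weight d x ^ (n + 1)" using \<eta> weight_pos[of d x] by simp
      then show ?thesis using v(4)[of 0 x] T init[OF that] that unfolding W0 by simp
    qed
  qed (use \<eta> in auto)
  then have "u1 t x \<le> u t x + Z t x + 3 * (\<eta> * W t x)"
    using v(4)[OF t x] unfolding W_def[symmetric] unfolding mult.assoc[of 2] mult.assoc[of 3] by linarith
  also have "3 * (\<eta> * W t x) \<le> e" using W_pos[of t x] e by (simp add: \<eta>_def field_simps)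
  finally show "u1 t x \<le> u t x + Z t x + e" by simp
qed

text \<open>
  The bound \<open>\<theta> Z\<close> on the difference bounds the difference of the sources by \<open>L \<theta> Z\<close>, which
  \<open>max (\<theta> / 2) 1 * Z\<close> absorbs. Iterating halves \<open>\<theta>\<close> until it is at most \<open>1\<close>.
\<close>

lemma difference_bound_halves:
  assumes T: "0 < T" and f: "L-lipschitz_on UNIV f" and L: "0 < L"
    and u: "two_sided_solution T d u (\<lambda>t x. f (u t x))"
    and u1: "two_sided_solution T d u1 (\<lambda>t x. f (u1 t x))"
    and u_growth: "\<And>t x. t \<in> {0..T} \<Longrightarrow> x \<in> Rd d \<Longrightarrow> \<bar>u t x\<bar> \<le> K * weight d x ^ n"
    and F_growth: "\<And>t x. t \<in> {0..T} \<Longrightarrow> x \<in> Rd d \<Longrightarrow> \<bar>f (u t x)\<bar> \<le> K * weight d x ^ n"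
    and u1_growth: "\<And>t x. t \<in> {0..T} \<Longrightarrow> x \<in> Rd d \<Longrightarrow> \<bar>u1 t x\<bar> \<le> K * weight d x ^ n"
    and Z: "heat_op T d Z HZ" "\<And>t x. t \<in> {0..T} \<Longrightarrow> x \<in> Rd d \<Longrightarrow> 0 \<le> Z t x"
      "\<And>t x. t \<in> {0<..<T} \<Longrightarrow> x \<in> Rd d \<Longrightarrow> 2 * L * Z t x \<le> HZ t x"
    and init: "\<And>x. x \<in> Rd d \<Longrightarrow> \<bar>u1 0 x - u 0 x\<bar> \<le> Z 0 x"
    and \<theta>: "\<And>t x. t \<in> {0..T} \<Longrightarrow> x \<in> Rd d \<Longrightarrow> \<bar>u1 t x - u t x\<bar> \<le> \<theta> * Z t x"
    and t: "t \<in> {0..T}" and x: "x \<in> Rd d"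
  shows "\<bar>u1 t x - u t x\<bar> \<le> max (\<theta> / 2) 1 * Z t x"
proof -
  define \<theta>' where "\<theta>' = max (\<theta> / 2) 1"
  have \<theta>': "1 \<le> \<theta>'" "\<theta> \<le> 2 * \<theta>'" by (auto simp: \<theta>'_def)
  have f_cont: "continuous_on UNIV f" using f by (rule lipschitz_on_continuous_on)
  have u_cont: "continuous_on ({0..T} \<times> Rd d) (\<lambda>(t, x). u t x)"
    using u by (simp add: two_sided_solution_def)
  have F: "continuous_on ({0..T} \<times> Rd d) (\<lambda>(t, x). f (u t x))"
    using continuous_on_compose2[OF f_cont u_cont] by (simp add: case_prod_beta')
  have F_neg: "continuous_on ({0..T} \<times> Rd d) (\<lambda>(t, x). - f (u t x))"
    using continuous_on_minus[OF F] by (simp add: case_prod_beta')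
  \<comment> \<open>The halving comes from the factor 2 in
    \<open>2 * L * Z t x \<le> HZ t x\<close>: the Lipschitz bound costs
    \<open>L * \<theta>\<close>, which is at most \<open>\<theta>' * (2 * L)\<close>.\<close>
  have source: "\<bar>f (u1 t x) - f (u t x)\<bar> \<le> \<theta>' * HZ t x" if "t \<in> {0<..<T}" "x \<in> Rd d" for t x
  proof -
    have t': "t \<in> {0..T}" using that by simp
    have "\<bar>f (u1 t x) - f (u t x)\<bar> \<le> L * \<bar>u1 t x - u t x\<bar>"
      using lipschitz_onD[OF f, of "u1 t x" "u t x"] by (simp add: dist_real_def)
    also have "\<dots> \<le> L * (\<theta> * Z t x)" using \<theta>[OF t' that(2)] L by (intro mult_left_mono) auto
    also have "\<dots> \<le> L * ((2 * \<theta>') * Z t x)"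
      using L \<theta>'(2) Z(2)[OF t' that(2)] by (intro mult_left_mono mult_right_mono) auto
    also have "\<dots> = \<theta>' * (2 * L * Z t x)" by simp
    also have "\<dots> \<le> \<theta>' * HZ t x" using Z(3)[OF that] \<theta>'(1) by (intro mult_left_mono) auto
    finally show ?thesis .
  qed
  have pos: "0 \<le> \<theta>' * Z t x" if "t \<in> {0..T}" "x \<in> Rd d" for t x
    using \<theta>'(1) Z(2)[OF that] by simp
  \<comment> \<open>The floor 1 in \<theta>' is due to the initial difference, whose bound
    \<open>Z\<close> does not improve during the iteration.\<close>
  have init': "\<bar>u1 0 x - u 0 x\<bar> \<le> \<theta>' * Z 0 x" if "x \<in> Rd d" for x
  proof -
    have "0 \<le> Z 0 x" using Z(2)[of 0 x] T that by simp
    then have "Z 0 x \<le> \<theta>' * Z 0 x" using mult_right_mono[OF \<theta>'(1), of "Z 0 x"] by simp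
    then show ?thesis using init[OF that] by linarith
  qed
  have "u1 t x \<le> u t x + \<theta>' * Z t x"
  proof (rule one_sided_stability[OF T u F u_growth F_growth _ _ _ heat_op_cmult[OF Z(1)] pos _ _ t x])
    show "global_subsolution T d u1 (\<lambda>t x. f (u1 t x))" "continuous_on ({0..T} \<times> Rd d) (\<lambda>(t, x). u1 t x)"
      using u1 by (auto simp: two_sided_solution_def)
    show "u1 t x \<le> K * weight d x ^ n" if "t \<in> {0..T}" "x \<in> Rd d" for t x
      using u1_growth[OF that] by linarith
    show "f (u1 t x) \<le> f (u t x) + \<theta>' * HZ t x" if "t \<in> {0<..<T}" "x \<in> Rd d" for t x
      using source[OF that] by linarith
    show "u1 0 x \<le> u 0 x + \<theta>' * Z 0 x" if "x \<in> Rd d" for x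
      using init'[OF that] by linarith
  qed
  moreover have "- u1 t x \<le> - u t x + \<theta>' * Z t x"
  proof (rule one_sided_stability[OF T two_sided_solution_neg[OF u] F_neg _ _ _ _ _ heat_op_cmult[OF Z(1)] pos _ _ t x])
    show "global_subsolution T d (\<lambda>t x. - u1 t x) (\<lambda>t x. - f (u1 t x))"
      "continuous_on ({0..T} \<times> Rd d) (\<lambda>(t, x). - u1 t x)"
      using two_sided_solution_neg[OF u1] by (auto simp: two_sided_solution_def)
    show "- u1 t x \<le> K * weight d x ^ n" if "t \<in> {0..T}" "x \<in> Rd d" for t x
      using u1_growth[OF that] by linarith
    show "\<bar>- u t x\<bar> \<le> K * weight d x ^ n" "\<bar>- f (u t x)\<bar> \<le> K * weight d x ^ n"
      if "t \<in> {0..T}" "x \<in> Rd d" for t x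
      using u_growth[OF that] F_growth[OF that] by simp_all
    show "- f (u1 t x) \<le> - f (u t x) + \<theta>' * HZ t x" if "t \<in> {0<..<T}" "x \<in> Rd d" for t x
      using source[OF that] by linarith
    show "- u1 0 x \<le> - u 0 x + \<theta>' * Z 0 x" if "x \<in> Rd d" for x
      using init'[OF that] by linarith
  qed
  ultimately show ?thesis unfolding \<theta>'_def by linarith
qed

text \<open>This plays the role of Gronwall's inequality, with the rate \<open>2 * L\<close> of the
  barriers. The initial difference may have a smaller exponent \<open>q\<close> than the growth
  exponent \<open>n\<close> of the solutions, so its barrier alone need not bound the difference by
  any multiple. Adding a small multiple of a barrier with exponent \<open>n\<close> provides a
  finite first factor.\<close>

lemma difference_bound:
  assumes T: "0 < T" and f: "L-lipschitz_on UNIV f" and L: "0 < L"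
    and u: "two_sided_solution T d u (\<lambda>t x. f (u t x))"
    and u1: "two_sided_solution T d u1 (\<lambda>t x. f (u1 t x))"
    and u_growth: "\<And>t x. t \<in> {0..T} \<Longrightarrow> x \<in> Rd d \<Longrightarrow> \<bar>u t x\<bar> \<le> K * weight d x ^ n"
    and u1_growth: "\<And>t x. t \<in> {0..T} \<Longrightarrow> x \<in> Rd d \<Longrightarrow> \<bar>u1 t x\<bar> \<le> K * weight d x ^ n"
    and A: "0 \<le> A" and init: "\<And>x. x \<in> Rd d \<Longrightarrow> \<bar>u1 0 x - u 0 x\<bar> \<le> A * weight d x ^ q"
    and t: "t \<in> {0..T}" and x: "x \<in> Rd d"
  shows "\<bar>u1 t x - u t x\<bar> \<le> A * barrier d q (2 * L) t x"
proof (rule field_le_epsilon)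
  fix e :: real assume e: "0 < e"
  define W where "W = barrier d n (2 * L)"
  define W1 where "W1 = barrier d q (2 * L)"
  have W_pos: "0 < W t x" "0 < W1 t x" for t x by (simp_all add: W_def W1_def barrier_pos)
  \<comment> \<open>At the point under consideration the auxiliary term
    \<open>\<sigma> * W t x\<close> equals \<open>e\<close>.\<close>
  define \<sigma> where "\<sigma> = e / W t x"
  have \<sigma>: "0 < \<sigma>" using e W_pos by (simp add: \<sigma>_def)
  obtain HW where HW: "heat_op T d W HW" "\<And>t x. 2 * L * W t x \<le> HW t x"
    unfolding W_def using heat_op_barrier by blast
  obtain HW1 where HW1: "heat_op T d W1 HW1" "\<And>t x. 2 * L * W1 t x \<le> HW1 t x"
    unfolding W1_def using heat_op_barrier by blast
  define Z where "Z = (\<lambda>t x. A * W1 t x + \<sigma> * W t x)"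
  have Z: "heat_op T d Z (\<lambda>t x. A * HW1 t x + \<sigma> * HW t x)"
    unfolding Z_def by (intro heat_op_add heat_op_cmult HW HW1)
  have Z_pos: "0 \<le> Z t x" for t x
    using A \<sigma> W_pos[of t x] by (simp add: Z_def)
  have HZ: "2 * L * Z t x \<le> A * HW1 t x + \<sigma> * HW t x" for t x
  proof -
    have "A * (2 * L * W1 t x) + \<sigma> * (2 * L * W t x) \<le> A * HW1 t x + \<sigma> * HW t x"
      using A \<sigma> by (intro add_mono mult_left_mono HW HW1) auto
    then show ?thesis by (simp add: Z_def algebra_simps)
  qed
  have Z0: "\<bar>u1 0 x - u 0 x\<bar> \<le> Z 0 x" if "x \<in> Rd d" for x
  proof -
    have "A * W1 0 x = A * weight d x ^ q" by (simp add: W1_def barrier_def)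
    moreover have "0 < \<sigma> * W 0 x" using \<sigma> W_pos by simp
    ultimately show ?thesis using init[OF that] unfolding Z_def by linarith
  qed
  have K: "0 \<le> K" 
  proof (rule ccontr)
    assume "\<not> 0 \<le> K"
    then have "K * weight d x ^ n < 0" using weight_pos[of d x] by (simp add: mult_neg_pos)
    then show False using u_growth[OF t x] by simp
  qed
  \<comment> \<open>One constant has to bound both \<open>u\<close> and its source, as
    \<open>one_sided_stability\<close> demands.\<close>
  define K' where "K' = max K (\<bar>f 0\<bar> + L * K)"
  have K': "K * weight d x ^ n \<le> K' * weight d x ^ n" for x
    using weight_pos[of d x] by (intro mult_right_mono) (auto simp: K'_def)
  have F_growth: "\<bar>f (u t x)\<bar> \<le> K' * weight d x ^ n" if "t \<in> {0..T}" "x \<in> Rd d" for t x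
  proof -
    have "\<bar>f (u t x)\<bar> \<le> \<bar>f 0\<bar> + L * \<bar>u t x\<bar>"
      using lipschitz_onD[OF f, of "u t x" 0] by (simp add: dist_real_def)
    also have "\<dots> \<le> \<bar>f 0\<bar> * weight d x ^ n + L * (K * weight d x ^ n)"
      using u_growth[OF that] L one_le_power[OF weight_ge_1[of d x], of n]
      by (intro add_mono mult_left_mono) (auto simp: mult_le_cancel_left1)
    also have "\<dots> \<le> K' * weight d x ^ n"
      using weight_pos[of d x] unfolding K'_def
      by (subst mult.assoc[symmetric], subst distrib_right[symmetric]) (intro mult_right_mono, auto)
    finally show ?thesis .
  qed
  have first: "\<bar>u1 t x - u t x\<bar> \<le> (2 * K / \<sigma>) * Z t x" if "t \<in> {0..T}" "x \<in> Rd d" for t x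
  proof -
    have "\<bar>u1 t x - u t x\<bar> \<le> 2 * K * weight d x ^ n"
      using u_growth[OF that] u1_growth[OF that] by linarith
    also have "\<dots> \<le> 2 * K * W t x"
      unfolding W_def using K L that by (intro mult_left_mono barrier_ge) auto
    also have "\<dots> = (2 * K / \<sigma>) * (\<sigma> * W t x)" using \<sigma> by simp
    also have "\<dots> \<le> (2 * K / \<sigma>) * Z t x"
      unfolding Z_def using K \<sigma> A W_pos(2)[of t x] by (intro mult_left_mono) auto
    finally show ?thesis .
  qed
  have iter: "\<bar>u1 t x - u t x\<bar> \<le> max (2 * K / \<sigma> / 2 ^ k) 1 * Z t x" if "t \<in> {0..T}" "x \<in> Rd d" for k t x
    using that
  proof (induction k arbitrary: t x)
    case 0
    have "(2 * K / \<sigma>) * Z t x \<le> max (2 * K / \<sigma> / 2 ^ 0) 1 * Z t x"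
      using Z_pos by (intro mult_right_mono) auto
    then show ?case using first[OF 0] by linarith
  next
    case (Suc k)
    have "\<bar>u1 t x - u t x\<bar> \<le> max (max (2 * K / \<sigma> / 2 ^ k) 1 / 2) 1 * Z t x"
    proof (rule difference_bound_halves[OF T f L u u1 _ F_growth _ Z Z_pos HZ Z0 Suc.IH Suc.prems])
      show "\<bar>u t x\<bar> \<le> K' * weight d x ^ n" "\<bar>u1 t x\<bar> \<le> K' * weight d x ^ n"
        if "t \<in> {0..T}" "x \<in> Rd d" for t x
        using u_growth[OF that] u1_growth[OF that] K'[of x] by linarith+
    qed
    also have "max (max c 1 / 2) 1 = max (c / 2) 1" for c :: real
      by (auto simp: max_def)
    also have "2 * K / \<sigma> / 2 ^ k / 2 = 2 * K / \<sigma> / 2 ^ Suc k" by simp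
    finally show ?case .
  qed
  \<comment> \<open>The number of halvings depends on \<open>K\<close> and, through \<sigma>, on
    \<open>e\<close>, but it leaves no trace in the bound that is reached.\<close>
  obtain k where "2 * K / \<sigma> < 2 ^ k" using real_arch_pow[of 2] by auto
  then have "2 * K / \<sigma> / 2 ^ k \<le> 1" by (simp add: divide_le_eq_1_pos del: divide_divide_eq_left)
  then have "\<bar>u1 t x - u t x\<bar> \<le> Z t x" using iter[OF t x, of k] by (simp add: max_absorb2)
  also have "\<dots> = A * barrier d q (2 * L) t x + e"
    using W_pos[of t x] by (simp add: Z_def W1_def \<sigma>_def)
  finally show "\<bar>u1 t x - u t x\<bar> \<le> A * barrier d q (2 * L) t x + e" .
qed

section \<open>A modulus of continuity\<close>

definition shift_Rd :: "nat \<Rightarrow> (nat \<Rightarrow> real) \<Rightarrow> (nat \<Rightarrow> real) \<Rightarrow> nat \<Rightarrow> real" where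
  "shift_Rd d h x = (\<lambda>i\<in>{..<d}. x i + h i)"

lemma shift_Rd_in_Rd: "shift_Rd d h x \<in> Rd d"
  by (auto simp: shift_Rd_def Rd_def)

lemma shift_Rd_inverse: "x \<in> Rd d \<Longrightarrow> shift_Rd d h (shift_Rd d (\<lambda>i. - h i) x) = x"
  and shift_Rd_inverse': "x \<in> Rd d \<Longrightarrow> shift_Rd d (\<lambda>i. - h i) (shift_Rd d h x) = x"
  by (auto simp: shift_Rd_def Rd_def PiE_def extensional_def fun_eq_iff)

lemma shift_Rd_upd: "i < d \<Longrightarrow> shift_Rd d h (x(i := s)) = (shift_Rd d h x)(i := s + h i)"
  by (auto simp: shift_Rd_def fun_eq_iff)

lemma continuous_on_shift:
  fixes A :: "real set"
  assumes "continuous_on (A \<times> Rd d) (\<lambda>(t, x). \<phi> t x)"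
  shows "continuous_on (A \<times> Rd d) (\<lambda>(t, x). \<phi> t (shift_Rd d h x))"
proof -
  have "continuous_on (A \<times> Rd d) (\<lambda>z. shift_Rd d h (snd z) i)" for i
    unfolding shift_Rd_def by (cases "i < d") (auto intro!: continuous_intros)
  then have cont: "continuous_on (A \<times> Rd d) (\<lambda>z. (fst z, shift_Rd d h (snd z)))"
    by (intro continuous_intros continuous_on_coordinatewise_then_product)
  have "(\<lambda>z. (fst z, shift_Rd d h (snd z))) ` (A \<times> Rd d) \<subseteq> A \<times> Rd d"
    using shift_Rd_in_Rd by auto
  from continuous_on_compose2[OF assms cont this] show ?thesis
    by (simp add: case_prod_beta')
qed

lemma C12_shift:
  assumes "C12 T d \<phi> \<phi>t D1 D2"
  shows "C12 T d (\<lambda>t x. \<phi> t (shift_Rd d h x)) (\<lambda>t x. \<phi>t t (shift_Rd d h x))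
    (\<lambda>i t x. D1 i t (shift_Rd d h x)) (\<lambda>i j t x. D2 i j t (shift_Rd d h x))"
proof -
  have *: "((\<lambda>s. \<psi> (shift_Rd d h (x(i := s)))) has_real_derivative D) (at (x i))"
    if "((\<lambda>s. \<psi> ((shift_Rd d h x)(i := s))) has_real_derivative D) (at (shift_Rd d h x i))" "i < d"
    for \<psi> :: "(nat \<Rightarrow> real) \<Rightarrow> real" and D x i
  proof -
    have "shift_Rd d h x i = x i + h i" using that(2) by (simp add: shift_Rd_def)
    then show ?thesis
      using that(1) DERIV_shift[of "\<lambda>s. \<psi> ((shift_Rd d h x)(i := s))" D "x i" "h i"]
      by (simp add: shift_Rd_upd[OF that(2)])
  qed
  show ?thesis
    using assms unfolding C12_def
    by (intro conjI ballI allI impI continuous_on_shift *) (blast intro: shift_Rd_in_Rd)+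
qed

text \<open>A translation maps \<open>Rd d\<close> onto itself, so global maxima stay global and it
  suffices to translate the test function back.\<close>

lemma global_subsolution_shift:
  assumes "global_subsolution T d u F"
  shows "global_subsolution T d (\<lambda>t x. u t (shift_Rd d h x)) (\<lambda>t x. F t (shift_Rd d h x))"
  unfolding global_subsolution_def
proof (intro allI impI ballI)
  fix \<phi> \<phi>t D1 D2 t x
  assume C: "C12 T d \<phi> \<phi>t D1 D2" and t: "t \<in> {0<..<T}" and x: "x \<in> Rd d"
    and max: "\<forall>s\<in>{0<..<T}. \<forall>y\<in>Rd d. u s (shift_Rd d h y) - \<phi> s y \<le> u t (shift_Rd d h x) - \<phi> t x"
  define h' where "h' = (\<lambda>i. - h i)"
  have "u s y - \<phi> s (shift_Rd d h' y)
      \<le> u t (shift_Rd d h x) - \<phi> t (shift_Rd d h' (shift_Rd d h x))"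
    if "s \<in> {0<..<T}" "y \<in> Rd d" for s y
    using bspec[OF bspec[OF max that(1)] shift_Rd_in_Rd, of h' y] that(2) x
    by (simp add: h'_def shift_Rd_inverse shift_Rd_inverse')
  then have "\<phi>t t (shift_Rd d h' (shift_Rd d h x)) \<le>
      (\<Sum>i<d. D2 i i t (shift_Rd d h' (shift_Rd d h x))) + F t (shift_Rd d h x)"
    using assms C12_shift[OF C, of h'] t shift_Rd_in_Rd[of d h x] unfolding global_subsolution_def by blast
  then show "\<phi>t t x \<le> (\<Sum>i<d. D2 i i t x) + F t (shift_Rd d h x)"
    using x by (simp add: h'_def shift_Rd_inverse')
qed

lemma two_sided_solution_shift:
  "two_sided_solution T d u F \<Longrightarrow>
    two_sided_solution T d (\<lambda>t x. u t (shift_Rd d h x)) (\<lambda>t x. F t (shift_Rd d h x))"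
  unfolding two_sided_solution_def
  using continuous_on_shift global_subsolution_shift[of T d u F h]
    global_subsolution_shift[of T d "\<lambda>t x. - u t x" "\<lambda>t x. - F t x" h] by blast

lemma two_sided_solution_if_viscosity:
  "viscosity_solution T d f g u \<Longrightarrow> two_sided_solution T d u (\<lambda>t x. f (u t x))"
  unfolding viscosity_solution_def two_sided_solution_def
  using global_subsolution_if_viscosity global_subsolution_neg_if_viscosity by blast

section \<open>Growth in terms of the weight\<close>

lemma norm_Rd_sq: "(norm_Rd d x)\<^sup>2 = weight d x - 1"
  by (simp add: norm_Rd_def L2_set_def weight_def sum_nonneg)

lemma norm_Rd_nonneg: "0 \<le> norm_Rd d x"
  by (simp add: norm_Rd_def)

lemma norm_Rd_le_weight: "norm_Rd d x \<le> weight d x"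
proof -
  have "0 \<le> (norm_Rd d x - 1)\<^sup>2" by simp
  then have "2 * norm_Rd d x \<le> (norm_Rd d x)\<^sup>2 + 1" by (simp add: power2_diff)
  then show ?thesis using norm_Rd_sq[of d x] weight_ge_1[of d x] by linarith
qed

lemma polynomial_growth_weight:
  assumes "polynomial_growth T d u"
  obtains K n where "\<And>t x. t \<in> {0..T} \<Longrightarrow> x \<in> Rd d \<Longrightarrow> \<bar>u t x\<bar> \<le> K * weight d x ^ n" "0 \<le> K"
proof -
  obtain K and n :: nat where
    K: "\<And>t x. t \<in> {0..T} \<Longrightarrow> x \<in> Rd d \<Longrightarrow> \<bar>u t x\<bar> \<le> K * (1 + norm_Rd d x ^ n)"
    using assms unfolding polynomial_growth_def by blast
  have "\<bar>u t x\<bar> \<le> (2 * \<bar>K\<bar>) * weight d x ^ n" if "t \<in> {0..T}" "x \<in> Rd d" for t x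
  proof -
    have "norm_Rd d x ^ n \<le> weight d x ^ n" "1 \<le> weight d x ^ n"
      using norm_Rd_nonneg norm_Rd_le_weight weight_ge_1 by (auto intro: power_mono one_le_power)
    then have "1 + norm_Rd d x ^ n \<le> 2 * weight d x ^ n" by linarith
    then have "\<bar>K\<bar> * (1 + norm_Rd d x ^ n) \<le> \<bar>K\<bar> * (2 * weight d x ^ n)" by (intro mult_left_mono) auto
    moreover have "K * (1 + norm_Rd d x ^ n) \<le> \<bar>K\<bar> * (1 + norm_Rd d x ^ n)"
      using norm_Rd_nonneg by (intro mult_right_mono) auto
    ultimately show ?thesis using K[OF that] by simp
  qed
  then show thesis by (intro that[of "2 * \<bar>K\<bar>" n]) auto
qed

lemma weight_shift_le: "weight d (shift_Rd d h x) \<le> 2 * weight d h * weight d x"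
proof -
  have "(\<Sum>i<d. (shift_Rd d h x i)\<^sup>2) \<le> (\<Sum>i<d. 2 * (x i)\<^sup>2 + 2 * (h i)\<^sup>2)"
  proof (rule sum_mono)
    fix i assume "i \<in> {..<d}"
    moreover have "(x i + h i)\<^sup>2 \<le> 2 * (x i)\<^sup>2 + 2 * (h i)\<^sup>2"
      using zero_le_power2[of "x i - h i"] unfolding power2_sum power2_diff by linarith
    ultimately show "(shift_Rd d h x i)\<^sup>2 \<le> 2 * (x i)\<^sup>2 + 2 * (h i)\<^sup>2" by (simp add: shift_Rd_def)
  qed
  also have "\<dots> = 2 * (weight d x - 1) + 2 * (weight d h - 1)"
    by (simp add: weight_def sum.distrib sum_distrib_left)
  finally have "weight d (shift_Rd d h x) \<le> 2 * (weight d x + weight d h - 1)"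
    by (simp add: weight_def)
  moreover have "0 \<le> (weight d x - 1) * (weight d h - 1)" using weight_ge_1 by simp
  ultimately show ?thesis by (simp add: algebra_simps)
qed

text \<open>A single translation carries \<open>x\<close> to \<open>y\<close>, and the translate of
  \<open>u\<close> solves the same equation because \<open>f\<close> does not depend on space. So
  the modulus of the initial value is propagated by \<open>difference_bound\<close>.\<close>

lemma viscosity_solution_modulus:
  fixes q :: nat
  assumes T: "0 < T" and f: "L-lipschitz_on UNIV f" and L: "0 < L"
    and u: "viscosity_solution T d f g u" and growth: "polynomial_growth T d u"
    and g: "\<And>R x y. 1 \<le> R \<Longrightarrow> x \<in> (\<Pi>\<^sub>E i\<in>{..<d}. {-R..R}) \<Longrightarrow> y \<in> (\<Pi>\<^sub>E i\<in>{..<d}. {-R..R}) \<Longrightarrow>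
        \<bar>g x - g y\<bar> \<le> c * R powr \<kappa> * dist_Rd d x y powr \<rho>"
    and c: "0 \<le> c" and \<kappa>: "\<kappa> \<le> 2 * real q" and \<rho>: "0 \<le> \<rho>"
    and x: "x \<in> Rd d" and y: "y \<in> Rd d"
    and \<delta>: "\<delta> \<le> 1" "\<And>i. i < d \<Longrightarrow> \<bar>y i - x i\<bar> \<le> \<delta>"
  shows "\<bar>u T y - u T x\<bar> \<le> c * 2 ^ q * (real d * \<delta>) powr \<rho> * barrier d q (2 * L) T x"
proof -
  define h where "h = (\<lambda>i. y i - x i)"
  have y_eq: "shift_Rd d h x = y"
    using x y by (auto simp: shift_Rd_def h_def Rd_def PiE_def extensional_def fun_eq_iff)
  obtain K n where K: "\<And>t x. t \<in> {0..T} \<Longrightarrow> x \<in> Rd d \<Longrightarrow> \<bar>u t x\<bar> \<le> K * weight d x ^ n" "0 \<le> K"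
    using polynomial_growth_weight[OF growth] by blast
  \<comment> \<open>Growth constant for \<open>u\<close> and its translate alike, in view of
    \<open>weight_shift_le\<close>.\<close>
  define K' where "K' = K * (2 * weight d h) ^ n"
  have "1 \<le> (2 * weight d h) ^ n" using weight_ge_1[of d h] by (intro one_le_power) linarith
  then have "K \<le> K'" using mult_left_mono[of 1 _ K] K(2) by (simp add: K'_def)
  have sol: "two_sided_solution T d u (\<lambda>t x. f (u t x))"
    by (rule two_sided_solution_if_viscosity[OF u])
  have "\<bar>u T (shift_Rd d h x) - u T x\<bar> \<le> (c * 2 ^ q * (real d * \<delta>) powr \<rho>) * barrier d q (2 * L) T x"
  proof (rule difference_bound[OF T f L sol two_sided_solution_shift[OF sol] _ _ _ _ _ x])
    fix t x assume t: "t \<in> {0..T}" and x: "x \<in> Rd d"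
    have "K * weight d x ^ n \<le> K' * weight d x ^ n"
      using \<open>K \<le> K'\<close> weight_pos[of d x] by (intro mult_right_mono) auto
    then show "\<bar>u t x\<bar> \<le> K' * weight d x ^ n" using K(1)[OF t x] by linarith
    have "\<bar>u t (shift_Rd d h x)\<bar> \<le> K * weight d (shift_Rd d h x) ^ n"
      using K(1)[OF t shift_Rd_in_Rd] .
    also have "\<dots> \<le> K * (2 * weight d h * weight d x) ^ n"
      using K(2) weight_pos[of d "shift_Rd d h x"] by (intro mult_left_mono power_mono weight_shift_le) auto
    finally show "\<bar>u t (shift_Rd d h x)\<bar> \<le> K' * weight d x ^ n"
      by (simp add: K'_def power_mult_distrib mult.assoc)
  next
    show "0 \<le> c * 2 ^ q * (real d * \<delta>) powr \<rho>" using c by simp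
  next
    fix x assume x: "x \<in> Rd d"
    \<comment> \<open>The cube of radius \<open>R\<close> contains \<open>x\<close> and, as
      \<open>\<delta> \<le> 1\<close>, its translate. Since
      \<open>R\<^sup>2 \<le> 2 * weight d x\<close> and \<open>\<kappa> \<le> 2 * real q\<close>,
      the factor \<open>R powr \<kappa>\<close> is at most
      \<open>(2 * weight d x) ^ q\<close>.\<close>
    define R where "R = 1 + norm_Rd d x"
    have R: "1 \<le> R" using norm_Rd_nonneg by (simp add: R_def)
    have coord: "\<bar>x i\<bar> \<le> norm_Rd d x" if "i < d" for i
      unfolding norm_Rd_def using member_le_L2_set[of "{..<d}" i "\<lambda>i. \<bar>x i\<bar>"] that
      by (simp add: L2_set_def)
    have "-R \<le> x i \<and> x i \<le> R" "-R \<le> x i + h i \<and> x i + h i \<le> R" if "i < d" for i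
      using coord[OF that] \<delta>(2)[OF that] \<delta>(1) unfolding R_def h_def by linarith+
    then have "x \<in> (\<Pi>\<^sub>E i\<in>{..<d}. {-R..R})" "shift_Rd d h x \<in> (\<Pi>\<^sub>E i\<in>{..<d}. {-R..R})"
      using x by (auto simp: Rd_def PiE_iff shift_Rd_def)
    then have "\<bar>g (shift_Rd d h x) - g x\<bar> \<le> c * R powr \<kappa> * dist_Rd d (shift_Rd d h x) x powr \<rho>"
      using g[OF R] by blast
    also have "\<dots> \<le> c * (2 ^ q * weight d x ^ q) * (real d * \<delta>) powr \<rho>"
    proof (intro mult_mono)
      have "R powr \<kappa> \<le> R powr (2 * real q)" using R \<kappa> by (intro powr_mono) auto
      also have "\<dots> = (R\<^sup>2) ^ q"
        using R powr_realpow[of R "2 * q"] by (simp add: power_mult)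
      also have "\<dots> \<le> (2 * weight d x) ^ q"
      proof (intro power_mono)
        have "0 \<le> (norm_Rd d x - 1)\<^sup>2" by simp
        then show "R\<^sup>2 \<le> 2 * weight d x"
          using norm_Rd_sq[of d x] unfolding R_def power2_sum power2_diff by simp
      qed simp
      finally show "R powr \<kappa> \<le> 2 ^ q * weight d x ^ q" by (simp add: power_mult_distrib)
      have "dist_Rd d (shift_Rd d h x) x = L2_set h {..<d}"
        unfolding dist_Rd_def by (rule L2_set_cong) (auto simp: shift_Rd_def)
      also have "\<dots> \<le> (\<Sum>i<d. \<bar>h i\<bar>)" by (rule L2_set_le_sum_abs)
      also have "\<dots> \<le> (\<Sum>i<d. \<delta>)" using \<delta>(2) by (intro sum_mono) (simp add: h_def)
      finally have "dist_Rd d (shift_Rd d h x) x \<le> real d * \<delta>" by simp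
      then show "dist_Rd d (shift_Rd d h x) x powr \<rho> \<le> (real d * \<delta>) powr \<rho>"
        using \<rho> by (intro powr_mono2) (auto simp: dist_Rd_def)
    qed (use c weight_pos[of d x] in auto)
    finally show "\<bar>u 0 (shift_Rd d h x) - u 0 x\<bar> \<le> c * 2 ^ q * (real d * \<delta>) powr \<rho> * weight d x ^ q"
      using u x shift_Rd_in_Rd by (simp add: viscosity_solution_def algebra_simps)
  qed (use T in auto)
  then show ?thesis unfolding y_eq .
qed

section \<open>Approximation in \<open>L\<^sup>p\<close> of the unit cube\<close>

abbreviation unit_cube :: "nat \<Rightarrow> (nat \<Rightarrow> real) set" where
  "unit_cube d \<equiv> \<Pi>\<^sub>E i\<in>{..<d}. {0..1}"

lemma unit_cube_subset_Rd: "unit_cube d \<subseteq> Rd d"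
  unfolding Rd_def by (rule PiE_mono) simp

lemma space_PiM_lborel: "space (PiM {..<d} (\<lambda>_. lborel)) = Rd d"
  by (simp add: space_PiM Rd_def)

lemma sets_unit_cube: "unit_cube d \<in> sets (PiM {..<d} (\<lambda>_. lborel))"
  by (rule sets_PiM_I_finite) auto

lemma space_unit_cube_measure: "space (unit_cube_measure d) = unit_cube d"
  using unit_cube_subset_Rd by (auto simp: unit_cube_measure_def space_restrict_space space_PiM_lborel)

lemma emeasure_lborel_PiE:
  fixes A :: "nat \<Rightarrow> real set"
  assumes "\<And>i. i < d \<Longrightarrow> A i \<in> sets borel"
  shows "emeasure (PiM {..<d} (\<lambda>_. lborel)) (\<Pi>\<^sub>E i\<in>{..<d}. A i) = (\<Prod>i<d. emeasure lborel (A i))"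
proof -
  interpret product_sigma_finite "\<lambda>_::nat. lborel :: real measure"
    by unfold_locales
  show ?thesis by (rule emeasure_PiM) (use assms in auto)
qed

lemma emeasure_space_unit_cube: "emeasure (unit_cube_measure d) (space (unit_cube_measure d)) = 1"
  unfolding space_unit_cube_measure unit_cube_measure_def
  using sets_unit_cube space_PiM_lborel unit_cube_subset_Rd
  by (subst emeasure_restrict_space) (auto simp: emeasure_lborel_PiE Int_absorb2)

lemma finite_measure_unit_cube: "finite_measure (unit_cube_measure d)"
  by (rule finite_measureI) (simp add: emeasure_space_unit_cube)

text \<open>Continuity refers to the topology of \<open>nat \<Rightarrow> real\<close>, the measure
  to the product over \<open>{..<d}\<close>. The identity map connects them: it is measurable
  because the coordinates off \<open>{..<d}\<close> are constant.\<close>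

lemma borel_measurable_unit_cube:
  assumes "continuous_on (Rd d) h"
  shows "h \<in> borel_measurable (unit_cube_measure d)"
proof -
  have "(\<lambda>x. x) \<in> measurable (PiM {..<d} (\<lambda>_. lborel)) (PiM UNIV (\<lambda>_. borel :: real measure))"
  proof (rule measurable_PiM_single')
    fix i :: nat
    show "(\<lambda>x. x i :: real) \<in> borel_measurable (PiM {..<d} (\<lambda>_. lborel))"
    proof (cases "i < d")
      case True
      then show ?thesis using measurable_component_singleton[of i "{..<d}" "\<lambda>_. lborel"] by simp
    next
      case False
      have "x i = undefined" if "x \<in> space (PiM {..<d} (\<lambda>_. lborel))" for x :: "nat \<Rightarrow> real"
        using that False by (auto simp: space_PiM_lborel Rd_def PiE_def extensional_def)
      then show ?thesis by (subst measurable_cong[where g = "\<lambda>_. undefined"]) auto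
    qed
  qed auto
  then have "(\<lambda>x. x) \<in> measurable (PiM {..<d} (\<lambda>_. lborel)) (borel :: (nat \<Rightarrow> real) measure)"
    by (simp cong: measurable_cong_sets add: sets_PiM_equal_borel)
  then have "(\<lambda>x. x) \<in> measurable (PiM {..<d} (\<lambda>_. lborel)) (restrict_space borel (Rd d))"
    by (intro measurable_restrict_space2) (auto simp: space_PiM_lborel)
  from measurable_comp[OF this borel_measurable_continuous_on_restrict[OF assms]]
  have "h \<in> borel_measurable (PiM {..<d} (\<lambda>_. lborel))" by (simp add: comp_def)
  then show ?thesis unfolding unit_cube_measure_def by (rule measurable_restrict_space1)
qed

lemma AE_unit_cube_coord_neq:
  assumes i: "i < d"
  shows "AE x in unit_cube_measure d. x i \<noteq> c"
proof -
  define N where "N = (\<Pi>\<^sub>E j\<in>{..<d}. if j = i then {c} else {0..1::real})"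
  have "emeasure (PiM {..<d} (\<lambda>_. lborel)) N = (\<Prod>j<d. emeasure lborel (if j = i then {c} else {0..1::real}))"
    unfolding N_def by (rule emeasure_lborel_PiE) auto
  also have "\<dots> = 0" using i by (auto intro!: bexI[of _ i])
  finally have "N \<in> null_sets (PiM {..<d} (\<lambda>_. lborel))"
    unfolding N_def by (auto intro!: null_setsI sets_PiM_I_finite)
  then have "AE x in PiM {..<d} (\<lambda>_. lborel). x \<notin> N" by (rule AE_not_in)
  then have "AE x in PiM {..<d} (\<lambda>_. lborel). x \<in> unit_cube d \<longrightarrow> x i \<noteq> c"
    by eventually_elim (use i in \<open>auto simp: N_def PiE_iff split: if_splits\<close>)
  then show ?thesis
    unfolding unit_cube_measure_def using sets_unit_cube by (subst AE_restrict_space_iff) auto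
qed

text \<open>The zeros lie in countably many hyperplane slices, each of measure zero.\<close>

lemma AE_unit_cube_sin_neq:
  assumes i: "i < d" and c: "0 < c"
  shows "AE x in unit_cube_measure d. sin (c * x i) \<noteq> 0"
proof -
  have "AE x in unit_cube_measure d. \<forall>k::int. x i \<noteq> of_int k * pi / c"
    by (subst AE_all_countable) (use AE_unit_cube_coord_neq[OF i] in auto)
  then show ?thesis
  proof eventually_elim
    case (elim x)
    show ?case
    proof
      assume "sin (c * x i) = 0"
      then obtain k :: int where "c * x i = of_int k * pi" by (auto simp: sin_zero_iff_int2)
      then have "x i = of_int k * pi / c" using c by (simp add: field_simps)
      with elim show False by blast
    qed
  qed
qed

text \<open>One index enumerates all \<open>d * J\<close> digits: \<open>m = i * J + j\<close>
  stands for digit \<open>j\<close> of coordinate \<open>i\<close>.\<close>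

definition digit_wave :: "nat \<Rightarrow> nat \<Rightarrow> (nat \<Rightarrow> real) \<Rightarrow> real" where
  "digit_wave J m x = sin (2 * pi * 2 ^ (m mod J) * x (m div J))"

text \<open>\<open>max 0 z - max 0 (z - 1)\<close> clamps \<open>z\<close> to \<open>[0, 1]\<close>;
  for steep \<open>K\<close> each clamped wave is 1 where the wave is negative and 0 where it is
  positive, up to a thin transition layer.\<close>

definition approx_code :: "nat \<Rightarrow> nat \<Rightarrow> real \<Rightarrow> (nat \<Rightarrow> real) \<Rightarrow> real" where
  "approx_code d J K x = (\<Sum>m<d * J. 2 ^ m *
     (max 0 (- K * digit_wave J m x) - max 0 (- K * digit_wave J m x - 1)))"

lemma div_less_if_less_mult: "m < d * J \<Longrightarrow> m div J < (d::nat)"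
  by (metis less_mult_imp_div_less)

text \<open>Each summand takes 11 operations, with its wave computed twice, since
  \<open>computes\<close> does not track shared values; the twelfth is the addition.\<close>

lemma computes_approx_code: "computes d (12 * (d * J)) (approx_code d J K)"
proof -
  have "computes d 11 (\<lambda>x. 2 ^ m *
     (max 0 (- K * digit_wave J m x) - max 0 (- K * digit_wave J m x - 1)))" if "m < d * J" for m
  proof -
    have w: "computes d 3 (\<lambda>x. - K * digit_wave J m x)"
      using computes_scale[OF computes_Sin[OF computes_scale[OF computes_Coord[OF div_less_if_less_mult[OF that]]]],
          of "- K" "2 * pi * 2 ^ (m mod J)"]
      unfolding digit_wave_def by (simp add: numeral_eq_Suc)
    show ?thesis
      using computes_scale[OF computes_Sub[OF computes_Max0[OF w] computes_Max0[OF computes_Sub[OF w computes_Const]]], of "2 ^ m" 1]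
      by simp
  qed
  from computes_sum[OF this, of "d * J" "\<lambda>m. m"] show ?thesis
    unfolding approx_code_def by (simp add: mult.commute)
qed

text \<open>A clamped wave reaches its limit exactly as soon as \<open>n\<close> is at least the
  reciprocal of the absolute value of the wave, and only finitely many waves occur.\<close>

lemma approx_code_eventually:
  assumes "\<And>m. m < d * J \<Longrightarrow> digit_wave J m x \<noteq> 0"
  shows "\<forall>\<^sub>F n in sequentially. approx_code d J (real n) x =
    real (\<Sum>m<d * J. 2 ^ m * of_bool (digit_wave J m x < 0))"
proof -
  have ev: "\<forall>\<^sub>F n in sequentially. max 0 (- real n * digit_wave J m x) - max 0 (- real n * digit_wave J m x - 1)
      = of_bool (digit_wave J m x < 0)" if "m < d * J" for m
  proof -
    define s where "s = digit_wave J m x"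
    have s: "s \<noteq> 0" using assms[OF that] by (simp add: s_def)
    obtain n0 :: nat where n0: "1 / \<bar>s\<bar> \<le> real n0" using real_arch_simple by blast
    have "max 0 (- real n * s) - max 0 (- real n * s - 1) = of_bool (s < 0)" if "n0 \<le> n" for n
    proof (cases "s < 0")
      case True
      have "1 / \<bar>s\<bar> \<le> real n" using n0 that by (meson of_nat_mono order_trans)
      then have "1 \<le> - real n * s" using True by (simp add: field_simps)
      then show ?thesis using True by simp
    next
      case False
      then have "0 \<le> real n * s" by simp
      then have "max 0 (- real n * s) = 0" "max 0 (- real n * s - 1) = 0" by simp_all
      then show ?thesis using False by simp
    qed
    then show ?thesis unfolding s_def eventually_sequentially by blast
  qed
  have "\<forall>\<^sub>F n in sequentially. \<forall>m\<in>{..<d * J}.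
      max 0 (- real n * digit_wave J m x) - max 0 (- real n * digit_wave J m x - 1)
      = of_bool (digit_wave J m x < 0)"
    by (subst eventually_ball_finite_distrib) (use ev in auto)
  then show ?thesis
    by eventually_elim (simp add: approx_code_def)
qed

lemma same_code_close:
  assumes x: "x \<in> unit_cube d" "\<And>m. m < d * J \<Longrightarrow> digit_wave J m x \<noteq> 0"
    and y: "y \<in> unit_cube d" "\<And>m. m < d * J \<Longrightarrow> digit_wave J m y \<noteq> 0"
    and eq: "(\<Sum>m<d * J. (2::nat) ^ m * of_bool (digit_wave J m x < 0)) =
      (\<Sum>m<d * J. 2 ^ m * of_bool (digit_wave J m y < 0))"
    and i: "i < d"
  shows "\<bar>x i - y i\<bar> \<le> 1 / 2 ^ J"
proof -
  have m: "i * J + j < d * J" "(i * J + j) div J = i" "(i * J + j) mod J = j" if "j < J" for j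
  proof -
    have "i * J + j < Suc i * J" using that by simp
    also have "\<dots> \<le> d * J" using i by (intro mult_le_mono1) auto
    finally show "i * J + j < d * J" .
  qed (use that in auto)
  show ?thesis
  proof (rule binary_digits_close)
    show "0 \<le> x i" "x i \<le> 1" "0 \<le> y i" "y i \<le> 1" using x(1) y(1) i by (auto simp: PiE_iff)
    fix j assume j: "j < J"
    show "sin (2 * pi * 2 ^ j * x i) \<noteq> 0" "sin (2 * pi * 2 ^ j * y i) \<noteq> 0"
      using x(2)[OF m(1)[OF j]] y(2)[OF m(1)[OF j]] m(2,3)[OF j] by (simp_all add: digit_wave_def)
    show "(sin (2 * pi * 2 ^ j * x i) < 0) = (sin (2 * pi * 2 ^ j * y i) < 0)"
      using binary_sum_inject[OF eq m(1)[OF j]] m(2,3)[OF j] by (simp add: digit_wave_def)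
  qed
qed

text \<open>At a point with an exact code the error is at most \<open>\<epsilon> / 2\<close>: the
  modulus and the table lookup contribute \<open>\<epsilon> / 4\<close> each. At almost every point
  the code is exact for steep enough waves, and dominated convergence, with the uniform bound
  \<open>2 * S\<close> on the error, handles the rest.\<close>

lemma expression_approximation:
  assumes p: "1 \<le> p" and \<epsilon>: "0 < \<epsilon>" and h: "continuous_on (Rd d) h"
    and modulus: "\<And>x y. x \<in> unit_cube d \<Longrightarrow> y \<in> unit_cube d \<Longrightarrow>
      (\<And>i. i < d \<Longrightarrow> \<bar>x i - y i\<bar> \<le> 1 / 2 ^ J) \<Longrightarrow> \<bar>h x - h y\<bar> \<le> \<epsilon> / 4"
  obtains \<Psi> where "finite_expression d (Rd d) \<Psi>"
    "in_Lp (unit_cube_measure d) p (\<lambda>x. h x - expression_val \<Psi> x)"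
    "Lp_norm (unit_cube_measure d) p (\<lambda>x. h x - expression_val \<Psi> x) \<le> \<epsilon>"
    "cost \<Psi> \<le> 12 * (d * J) + 5"
proof -
  let ?M = "unit_cube_measure d"
  interpret finite_measure ?M by (rule finite_measure_unit_cube)
  have cube_box: "unit_cube d \<subseteq> box_Rd d 1" "box_Rd d 1 \<subseteq> Rd d"
    by (fastforce simp: box_Rd_def Rd_def PiE_iff)+
  have "bounded (h ` box_Rd d 1)"
    using continuous_on_subset[OF h cube_box(2)] compact_box_Rd
    by (intro compact_imp_bounded compact_continuous_image)
  then obtain S0 where S0: "\<forall>z\<in>h ` box_Rd d 1. norm z \<le> S0" unfolding bounded_iff by blast
  define S where "S = max S0 1"
  have S: "1 \<le> S" "\<And>x. x \<in> unit_cube d \<Longrightarrow> \<bar>h x\<bar> \<le> S"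
    using S0 cube_box by (auto simp: S_def intro!: max.coboundedI1)
  define good where "good = (\<lambda>x. \<forall>m<d * J. digit_wave J m x \<noteq> 0)"
  define code where "code = (\<lambda>x. \<Sum>m<d * J. (2::nat) ^ m * of_bool (digit_wave J m x < 0))"
  define P where "P = (\<lambda>k r. r \<in> unit_cube d \<and> good r \<and> code r = k)"
  \<comment> \<open>A code realised by a good point gets the value of \<open>h\<close> at one such
    point, scaled into \<open>[-1, 1]\<close>; the value 0 for the other codes is arbitrary.\<close>
  define y where "y = (\<lambda>k. if \<exists>r. P k r then h (SOME r. P k r) / S else 0)"
  have P_some: "P k (SOME r. P k r)" if "P k r" for k r by (rule someI[of "P k"]) (rule that)
  have P_cube: "r \<in> unit_cube d" if "P k r" for k r using that by (simp add: P_def)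
  have y_le: "\<bar>y k\<bar> \<le> 1" for k
  proof (cases "\<exists>r. P k r")
    case True
    then obtain r where "P k r" by blast
    from S(2)[OF P_cube[OF P_some[OF this]]] show ?thesis using True S(1) by (simp add: y_def abs_divide)
  next
    case False
    then have "y k = 0" unfolding y_def by (rule if_not_P)
    then show ?thesis by simp
  qed
  have \<epsilon>S: "0 < \<epsilon> / 4 / S" using \<epsilon> S(1) by simp
  obtain a b where ab: "\<And>k. k < 2 ^ (d * J) \<Longrightarrow> \<bar>sin (a * 2 powr (b * real k)) - y k\<bar> \<le> \<epsilon> / 4 / S"
    by (rule lookup_exists[of y, OF y_le \<epsilon>S, of "2 ^ (d * J)"]) (rule that)
  define \<Phi> where "\<Phi> = (\<lambda>n x. S * sin (a * 2 powr (b * approx_code d J (real n) x)))"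
  have \<Phi>_le: "\<bar>\<Phi> n x\<bar> \<le> S" for n x
    using S(1) by (simp add: \<Phi>_def abs_mult mult_left_le)
  have close: "\<bar>h x - S * sin (a * 2 powr (b * real (code x)))\<bar> \<le> \<epsilon> / 2"
    if x: "x \<in> unit_cube d" and "good x" for x
  proof -
    define r where "r = (SOME r. P (code x) r)"
    have Px: "P (code x) x" using that by (simp add: P_def)
    have r: "r \<in> unit_cube d" "good r" "code r = code x"
      using P_some[OF Px] by (auto simp: P_def r_def)
    have "\<bar>h x - h r\<bar> \<le> \<epsilon> / 4"
      by (rule modulus[OF x r(1)], rule same_code_close[OF x _ r(1)])
        (use that(2) r(2,3) in \<open>auto simp: good_def code_def\<close>)
    moreover have "y (code x) = h r / S" using Px by (auto simp: y_def r_def)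
    then have "\<bar>sin (a * 2 powr (b * real (code x))) - h r / S\<bar> \<le> \<epsilon> / 4 / S"
      using ab[of "code x"] binary_sum_less by (simp add: code_def)
    then have "S * \<bar>sin (a * 2 powr (b * real (code x))) - h r / S\<bar> \<le> S * (\<epsilon> / 4 / S)"
      using S(1) by (intro mult_left_mono) auto
    then have "\<bar>S * sin (a * 2 powr (b * real (code x))) - h r\<bar> \<le> \<epsilon> / 4"
      using S(1) by (simp add: abs_mult[symmetric] abs_mult_pos' right_diff_distrib)
    ultimately show ?thesis by linarith
  qed
  have good_AE: "AE x in ?M. good x"
  proof -
    have "AE x in ?M. \<forall>m\<in>{..<d * J}. digit_wave J m x \<noteq> 0"
      unfolding digit_wave_def
      by (rule AE_finite_allI) (auto intro!: AE_unit_cube_sin_neq simp: div_less_if_less_mult)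
    then show ?thesis by (simp add: good_def Ball_def)
  qed
  define err where "err = (\<lambda>n x. \<bar>h x - \<Phi> n x\<bar> powr p)"
  \<comment> \<open>The excess over the admissible error; at almost every point it vanishes for all
    large \<open>n\<close>.\<close>
  define exc where "exc = (\<lambda>n x. max 0 (err n x - (\<epsilon> / 2) powr p))"
  have meas: "(\<lambda>x. h x - \<Phi> n x) \<in> borel_measurable ?M" for n
  proof (rule borel_measurable_unit_cube)
    show "continuous_on (Rd d) (\<lambda>x. h x - \<Phi> n x)"
      unfolding \<Phi>_def approx_code_def digit_wave_def
      by (intro continuous_intros h) auto
  qed
  have err_meas: "err n \<in> borel_measurable ?M" for n
    unfolding err_def using meas[of n] by measurable
  have err_le: "err n x \<le> (2 * S) powr p" if "x \<in> unit_cube d" for n x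
    unfolding err_def using S(2)[OF that] \<Phi>_le[of n x] p by (intro powr_mono2) auto
  have err_abs_le: "\<bar>err n x\<bar> \<le> (2 * S) powr p" if "x \<in> unit_cube d" for n x
    using err_le[OF that, of n] by (simp add: err_def)
  have err_int: "integrable ?M (err n)" for n
    by (rule integrable_const_bound[of _ "(2 * S) powr p"])
      (auto intro!: AE_I2 simp: err_meas err_abs_le space_unit_cube_measure)
  have exc_le: "\<bar>exc n x\<bar> \<le> (2 * S) powr p" if "x \<in> unit_cube d" for n x
  proof -
    have "0 \<le> err n x" "0 \<le> (\<epsilon> / 2) powr p" by (simp_all add: err_def)
    then show ?thesis unfolding exc_def using err_le[OF that, of n] by linarith
  qed
  have exc_meas: "exc n \<in> borel_measurable ?M" for n
    unfolding exc_def using err_meas by measurable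
  have exc_lim: "AE x in ?M. (\<lambda>n. exc n x) \<longlonglongrightarrow> 0"
    using good_AE AE_space
  proof eventually_elim
    case (elim x)
    then have x: "x \<in> unit_cube d" by (simp add: space_unit_cube_measure)
    have "\<forall>\<^sub>F n in sequentially. approx_code d J (real n) x = real (code x)"
      unfolding code_def using elim(1) by (intro approx_code_eventually) (simp add: good_def)
    then have "\<forall>\<^sub>F n in sequentially. exc n x = 0"
    proof eventually_elim
      case (elim n)
      have "\<bar>h x - \<Phi> n x\<bar> powr p \<le> (\<epsilon> / 2) powr p"
        using close[OF x \<open>good x\<close>] p elim by (intro powr_mono2) (auto simp: \<Phi>_def)
      then show ?case by (simp add: exc_def err_def)
    qed
    then show ?case by (rule tendsto_eventually)
  qed
  have "(\<lambda>n. \<integral>x. exc n x \<partial>?M) \<longlonglongrightarrow> (\<integral>x. 0 \<partial>?M)"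
    by (rule integral_dominated_convergence[where w = "\<lambda>_. (2 * S) powr p"])
      (use exc_lim exc_meas exc_le in \<open>auto intro!: AE_I2 simp: space_unit_cube_measure\<close>)
  then have "(\<lambda>n. \<integral>x. exc n x \<partial>?M) \<longlonglongrightarrow> 0" by simp
  moreover have \<epsilon>p: "0 < (\<epsilon> / 2) powr p" using \<epsilon> by simp
  ultimately have "\<forall>\<^sub>F n in sequentially. (\<integral>x. exc n x \<partial>?M) < (\<epsilon> / 2) powr p"
    by (rule order_tendstoD(2))
  then obtain n where n: "(\<integral>x. exc n x \<partial>?M) < (\<epsilon> / 2) powr p"
    by (auto simp: eventually_sequentially)
  have exc_int: "integrable ?M (exc n)"
    by (rule integrable_const_bound[of _ "(2 * S) powr p"])
      (auto intro!: AE_I2 simp: exc_meas exc_le space_unit_cube_measure)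
  have "(\<integral>x. err n x \<partial>?M) \<le> (\<integral>x. (\<epsilon> / 2) powr p + exc n x \<partial>?M)"
    by (intro integral_mono err_int Bochner_Integration.integrable_add exc_int) (auto simp: exc_def)
  also have "\<dots> = (\<epsilon> / 2) powr p + (\<integral>x. exc n x \<partial>?M)"
    using exc_int by (simp add: Bochner_Integration.integral_add measure_def emeasure_space_unit_cube)
  also have "\<dots> \<le> 2 * (\<epsilon> / 2) powr p" using n by simp
  \<comment> \<open>Since \<open>p \<ge> 1\<close>, the factor 2 is at most \<open>2 powr p\<close>,
    which turns \<open>\<epsilon> / 2\<close> back into \<epsilon>.\<close>
  also have "\<dots> \<le> 2 powr p * (\<epsilon> / 2) powr p"
    using p powr_mono[of 1 p 2] by (intro mult_right_mono) auto
  also have "\<dots> = \<epsilon> powr p" using \<epsilon> by (simp flip: powr_mult)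
  finally have le: "(\<integral>x. err n x \<partial>?M) \<le> \<epsilon> powr p" .
  have "0 \<le> (\<integral>x. err n x \<partial>?M)" by (simp add: err_def)
  with le have "(\<integral>x. err n x \<partial>?M) powr (1 / p) \<le> (\<epsilon> powr p) powr (1 / p)"
    using p by (intro powr_mono2) auto
  also have "\<dots> = \<epsilon>" using p \<epsilon> by (simp add: powr_powr)
  finally have norm_le: "(\<integral>x. err n x \<partial>?M) powr (1 / p) \<le> \<epsilon>" .
  \<comment> \<open>Five operations beyond the code: the factors \<open>b\<close>, \<open>a\<close>
    and \<open>S\<close>, the exponential and the sine.\<close>
  have "computes d (12 * (d * J) + 1 + 1 + 1 + 1 + 1) (\<Phi> n)"
    unfolding \<Phi>_def by (intro computes_scale computes_Sin computes_Exp2 computes_approx_code)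
  then obtain \<Psi> where \<Psi>: "finite_expression d (Rd d) \<Psi>" "cost \<Psi> \<le> 12 * (d * J) + 1 + 1 + 1 + 1 + 1"
    "expression_val \<Psi> = \<Phi> n"
    by (rule computes_expression)
  show thesis
    by (rule that[OF \<Psi>(1)])
      (use \<Psi>(2,3) meas err_int norm_le in \<open>auto simp: in_Lp_def Lp_norm_def err_def\<close>)
qed

section \<open>Choice of the mesh\<close>

lemma powr_le_exp: "0 \<le> c \<Longrightarrow> 0 \<le> x \<Longrightarrow> x powr c \<le> exp (c * x)" for x c :: real
proof -
  assume "0 \<le> c" "0 \<le> x"
  have "x \<le> exp x" using exp_ge_add_one_self[of x] by linarith
  then have "x powr c \<le> exp x powr c" using \<open>0 \<le> c\<close> \<open>0 \<le> x\<close> by (intro powr_mono2) auto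
  then show ?thesis by (simp add: powr_def mult.commute)
qed

theorem theorem4p1:
  fixes T p \<rho> L C\<^sub>0 \<kappa> m :: real
  assumes "0 < T" and "1 \<le> p" and "0 < \<rho>" and "\<rho> \<le> 1"
    and "1 \<le> L" and "1 \<le> C\<^sub>0" and "1 \<le> \<kappa>" and "0 \<le> m"
  shows "\<exists>C \<alpha>. 0 < C \<and> 0 < \<alpha> \<and>
    (\<forall>(f :: real \<Rightarrow> real) (g :: nat \<Rightarrow> (nat \<Rightarrow> real) \<Rightarrow> real)
      (u :: nat \<Rightarrow> real \<Rightarrow> (nat \<Rightarrow> real) \<Rightarrow> real).
      L-lipschitz_on UNIV f \<and> \<bar>f 0\<bar> \<le> L \<and>
      (\<forall>d\<ge>1. continuous_on (Rd d) (g d) \<and>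
        (\<forall>x\<in>Rd d. \<bar>g d x\<bar> \<le> C\<^sub>0 * real d powr \<kappa> * (1 + rpow (norm_Rd d x) m)) \<and>
        (\<forall>R\<ge>1. \<forall>x\<in>(\<Pi>\<^sub>E i\<in>{..<d}. {-R..R}). \<forall>y\<in>(\<Pi>\<^sub>E i\<in>{..<d}. {-R..R}).
          \<bar>g d x - g d y\<bar> \<le> C\<^sub>0 * real d powr \<kappa> * R powr \<kappa> * dist_Rd d x y powr \<rho>)) \<and>
      (\<forall>d\<ge>1. viscosity_solution T d f (g d) (u d) \<and> polynomial_growth T d (u d))
      \<longrightarrow>
      (\<forall>d\<ge>1. \<forall>\<epsilon>. 0 < \<epsilon> \<and> \<epsilon> \<le> 1 \<longrightarrow>
        (\<exists>\<Psi>. finite_expression d (Rd d) \<Psi> \<and>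
          in_Lp (unit_cube_measure d) p (\<lambda>x. u d T x - expression_val \<Psi> x) \<and>
          Lp_norm (unit_cube_measure d) p (\<lambda>x. u d T x - expression_val \<Psi> x) \<le> \<epsilon> \<and>
          real (cost \<Psi>) \<le> C * real d powr \<alpha> * \<epsilon> powr (- \<alpha>))))"
proof -
  define q where "q = nat \<lceil>\<kappa>\<rceil>"
  have q: "\<kappa> \<le> 2 * real q" using assms(7) unfolding q_def by linarith
  \<comment> \<open>Every factor of the modulus at time \<open>T\<close> is bounded by an
    exponential linear in \<open>d\<close>, and \<open>E\<close> adds up the rates. The first
    \<open>real q\<close> belongs to \<open>2 ^ q\<close>, the last to the weight on the unit
    cube.\<close>
  define E where "E = C\<^sub>0 + \<kappa> + real q + \<rho> + (2 * L + 4 * (real q)\<^sup>2 + 2 * real q) * T + real q"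
  have E: "0 < E" unfolding E_def using assms by (intro add_pos_nonneg add_nonneg_nonneg mult_nonneg_nonneg) auto
  \<comment> \<open>Then \<open>\<rho> * ln 2\<close> times \<open>c * d / \<epsilon>\<close> is
    \<open>(E + 4) * (d / \<epsilon>)\<close>, at least \<open>E * d + 4 / \<epsilon>\<close>: the
    mesh beats the growth in \<open>d\<close> and leaves
    \<open>exp (- (4 / \<epsilon>))\<close>.\<close>
  define c where "c = (E + 4) / (\<rho> * ln 2)"
  have c: "0 < c" using E assms(3) by (simp add: c_def)
  have main: "\<exists>\<Psi>. finite_expression d (Rd d) \<Psi> \<and>
          in_Lp (unit_cube_measure d) p (\<lambda>x. u T x - expression_val \<Psi> x) \<and>
          Lp_norm (unit_cube_measure d) p (\<lambda>x. u T x - expression_val \<Psi> x) \<le> \<epsilon> \<and>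
          real (cost \<Psi>) \<le> (12 * (c + 1) + 5) * real d powr 2 * \<epsilon> powr (- 2)"
    if f: "L-lipschitz_on UNIV f"
      and g: "\<forall>R\<ge>1. \<forall>x\<in>(\<Pi>\<^sub>E i\<in>{..<d}. {-R..R}). \<forall>y\<in>(\<Pi>\<^sub>E i\<in>{..<d}. {-R..R}).
          \<bar>g x - g y\<bar> \<le> C\<^sub>0 * real d powr \<kappa> * R powr \<kappa> * dist_Rd d x y powr \<rho>"
      and u: "viscosity_solution T d f g u" "polynomial_growth T d u"
      and d: "1 \<le> d" and \<epsilon>: "0 < \<epsilon>" "\<epsilon> \<le> 1"
    for f g u d and \<epsilon> :: real
  proof -
    \<comment> \<open>Logarithmic dependence on \<open>1 / \<epsilon>\<close> would be enough;
      \<open>d / \<epsilon>\<close> keeps the cost polynomial and needs only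
      \<open>x \<le> exp x\<close>.\<close>
    define J where "J = nat \<lceil>c * real d / \<epsilon>\<rceil>"
    have "0 \<le> c * real d / \<epsilon>" using c \<epsilon> by simp
    then have J: "c * real d / \<epsilon> \<le> real J" "real J \<le> c * real d / \<epsilon> + 1"
      unfolding J_def by linarith+
    have d\<epsilon>: "1 \<le> real d / \<epsilon>" using d \<epsilon> by (simp add: field_simps)
    have d1: "real d \<le> real d / \<epsilon>" "1 / \<epsilon> \<le> real d / \<epsilon>"
      using d \<epsilon> by (auto simp: field_simps mult_le_cancel_left1)
    have modulus: "\<bar>u T y - u T x\<bar> \<le> \<epsilon> / 4"
      if x: "x \<in> unit_cube d" and y: "y \<in> unit_cube d"
        and xy: "\<And>i. i < d \<Longrightarrow> \<bar>y i - x i\<bar> \<le> 1 / 2 ^ J" for x y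
    proof -
      have "\<bar>u T y - u T x\<bar> \<le> C\<^sub>0 * real d powr \<kappa> * 2 ^ q * (real d * (1 / 2 ^ J)) powr \<rho> * barrier d q (2 * L) T x"
        by (rule viscosity_solution_modulus[OF assms(1) f _ u _ _ q _ _ _ _ xy])
          (use g assms x y unit_cube_subset_Rd[of d] in auto)
      also have "\<dots> \<le> (exp (C\<^sub>0 * d) * exp (\<kappa> * d) * exp (q * d) * (exp (\<rho> * d) * exp (- (\<rho> * J * ln 2)))) *
          (exp ((2 * L + 4 * (real q)\<^sup>2 + 2 * real q) * T * d) * exp (q * d))"
      proof (intro mult_mono)
        show "C\<^sub>0 \<le> exp (C\<^sub>0 * d)"
        proof -
          have "C\<^sub>0 * 1 \<le> C\<^sub>0 * d" using assms(6) d by (intro mult_left_mono) auto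
          then show ?thesis using exp_ge_add_one_self[of "C\<^sub>0 * d"] by linarith
        qed
        show "real d powr \<kappa> \<le> exp (\<kappa> * d)" using assms(7) by (intro powr_le_exp) auto
        show "2 ^ q \<le> exp (real (q * d))"
        proof -
          have "(2::real) ^ q \<le> exp 1 ^ q" using exp_ge_add_one_self[of 1] by (intro power_mono) auto
          also have "\<dots> = exp (real q)" by (simp flip: exp_of_nat_mult)
          also have "\<dots> \<le> exp (real (q * d))" using d by (simp add: mult_le_cancel_left1)
          finally show ?thesis .
        qed
        show "(real d * (1 / 2 ^ J)) powr \<rho> \<le> exp (\<rho> * d) * exp (- (\<rho> * J * ln 2))"
        proof -
          have "(1 / 2 ^ J) powr \<rho> = exp (- (\<rho> * J * ln 2))"
            by (simp add: powr_def ln_div ln_realpow)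
          moreover have "(real d * (1 / 2 ^ J)) powr \<rho> = real d powr \<rho> * (1 / 2 ^ J) powr \<rho>"
            by (rule powr_mult)
          moreover have "real d powr \<rho> \<le> exp (\<rho> * d)" using assms(3) by (intro powr_le_exp) auto
          ultimately show ?thesis by simp
        qed
        show "barrier d q (2 * L) T x \<le> exp ((2 * L + 4 * (real q)\<^sup>2 + 2 * real q) * T * d) * exp (q * d)"
          unfolding barrier_def
        proof (intro mult_mono)
          have "2 * L + 4 * (real q)\<^sup>2 + 2 * real d * real q \<le> (2 * L + 4 * (real q)\<^sup>2 + 2 * real q) * d"
          proof -
            have "(2 * L + 4 * (real q)\<^sup>2) * 1 \<le> (2 * L + 4 * (real q)\<^sup>2) * d"
              using assms(5) d by (intro mult_left_mono) auto
            then show ?thesis by (simp add: algebra_simps)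
          qed
          then have "(2 * L + 4 * (real q)\<^sup>2 + 2 * real d * real q) * T
              \<le> ((2 * L + 4 * (real q)\<^sup>2 + 2 * real q) * d) * T"
            using assms(1) by (intro mult_right_mono) auto
          then show "exp ((2 * L + 4 * (real q)\<^sup>2 + 2 * real d * real q) * T)
              \<le> exp ((2 * L + 4 * (real q)\<^sup>2 + 2 * real q) * T * d)"
            by (simp add: algebra_simps)
          have "(\<Sum>i<d. (x i)\<^sup>2) \<le> (\<Sum>i<d. 1)"
            using x by (intro sum_mono) (auto simp: PiE_iff power_le_one)
          then have "(\<Sum>i<d. (x i)\<^sup>2) \<le> real d" by simp
          then have "weight d x \<le> exp d"
            unfolding weight_def using exp_ge_add_one_self[of "real d"] by linarith
          then have "weight d x ^ q \<le> exp d ^ q" using weight_pos[of d x] by (intro power_mono) auto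
          then show "weight d x ^ q \<le> exp (real (q * d))" by (simp flip: exp_of_nat_mult)
        qed (use weight_pos[of d x] in auto)
      qed (use assms in \<open>auto intro: barrier_pos[THEN less_imp_le]\<close>)
      also have "\<dots> = exp (E * d - \<rho> * J * ln 2)"
        unfolding mult_exp_exp by (simp add: E_def algebra_simps)
      also have "\<dots> \<le> exp (- (4 / \<epsilon>))"
      proof -
        have "(E + 4) * (d / \<epsilon>) = \<rho> * ln 2 * (c * real d / \<epsilon>)"
          using assms(3) by (simp add: c_def)
        also have "\<dots> \<le> \<rho> * ln 2 * J" using J(1) assms(3) by (intro mult_left_mono) auto
        finally have "E * (d / \<epsilon>) + 4 * (d / \<epsilon>) \<le> \<rho> * J * ln 2" by (simp add: algebra_simps)
        moreover have "E * d \<le> E * (d / \<epsilon>)" using E d1(1) by (intro mult_left_mono) auto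
        moreover have "4 / \<epsilon> \<le> 4 * (d / \<epsilon>)" using d1(2) by simp
        ultimately show ?thesis by simp
      qed
      also have "\<dots> \<le> \<epsilon> / 4"
      proof -
        have "4 / \<epsilon> \<le> exp (4 / \<epsilon>)" using exp_ge_add_one_self[of "4 / \<epsilon>"] by linarith
        then have "inverse (exp (4 / \<epsilon>)) \<le> inverse (4 / \<epsilon>)" using \<epsilon> by (intro le_imp_inverse_le) auto
        then show ?thesis by (simp add: exp_minus)
      qed
      finally show ?thesis .
    qed
    have u_cont: "continuous_on ({0..T} \<times> Rd d) (\<lambda>(t, x). u t x)"
      using u(1) by (simp add: viscosity_solution_def)
    have "continuous_on (Rd d) (\<lambda>x. (T, x))" "(\<lambda>x. (T, x)) ` Rd d \<subseteq> {0..T} \<times> Rd d"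
      using assms(1) by (auto intro!: continuous_intros)
    from continuous_on_compose2[OF u_cont this] have uT_cont: "continuous_on (Rd d) (u T)"
      by simp
    obtain \<Psi> where \<Psi>: "finite_expression d (Rd d) \<Psi>"
      "in_Lp (unit_cube_measure d) p (\<lambda>x. u T x - expression_val \<Psi> x)"
      "Lp_norm (unit_cube_measure d) p (\<lambda>x. u T x - expression_val \<Psi> x) \<le> \<epsilon>"
      "cost \<Psi> \<le> 12 * (d * J) + 5"
      by (rule expression_approximation[OF assms(2) \<epsilon>(1) uT_cont modulus])
    have "real (cost \<Psi>) \<le> 12 * (real d * real J) + 5"
      using \<Psi>(4) by (metis (mono_tags) of_nat_add of_nat_le_iff of_nat_mult of_nat_numeral)
    also have "\<dots> \<le> 12 * ((c + 1) * (d / \<epsilon>)\<^sup>2) + 5 * (d / \<epsilon>)\<^sup>2"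
    proof -
      have "real J \<le> (c + 1) * (d / \<epsilon>)" 
        using J(2) d\<epsilon> unfolding times_divide_eq_right distrib_right add_divide_distrib mult_1_left
        by linarith
      then have "real d * real J \<le> (d / \<epsilon>) * ((c + 1) * (d / \<epsilon>))"
        using d1(1) by (intro mult_mono) auto
      then have "real d * real J \<le> (c + 1) * (d / \<epsilon>)\<^sup>2"
        unfolding power2_eq_square by (simp only: mult.left_commute)
      moreover have "1 \<le> (d / \<epsilon>)\<^sup>2" using d\<epsilon> by (rule one_le_power)
      ultimately show ?thesis by linarith
    qed
    also have "\<dots> = (12 * (c + 1) + 5) * (d / \<epsilon>)\<^sup>2" by (simp add: distrib_right)
    also have "(d / \<epsilon>)\<^sup>2 = real d powr 2 * \<epsilon> powr (- 2)"
      using d \<epsilon> by (simp add: powr_minus_divide powr_numeral power_divide)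
    finally have "real (cost \<Psi>) \<le> (12 * (c + 1) + 5) * real d powr 2 * \<epsilon> powr (- 2)"
      by (simp only: mult.assoc)
    with \<Psi> show ?thesis by blast
  qed
  \<comment> \<open>The exponent is 2 because \<open>d * J\<close> is of order
    \<open>d * (d / \<epsilon>)\<close>, bounded by the square of
    \<open>d / \<epsilon>\<close>.\<close>
  show ?thesis
    by (rule exI[of _ "12 * (c + 1) + 5"], rule exI[of _ 2]) (use c main in auto)
qed

end
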